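(* For every integer $n\geq 1$ there exists a compact metric space $Y$ of topological dimension $n$ and a homeomorphism $S\colon Y\to Y$ which is weakly mixing and completely scrambled.
   Context: Let $(X,d)$ be a compact metric space and $T\colon X\to X$ continuous. A pair $x,y\in X$ is proximal if $\liminf_{n\to\infty} d(T^n(x),T^n(y))=0$, asymptotic if $\limsup_{n\to\infty} d(T^n(x),T^n(y))=0$, and Li-Yorke if it is proximal but not asymptotic. $(X,T)$ is completely scrambled if every pair of distinct points is a Li-Yorke pair. $(X,T)$ is transitive if for any nonempty open $U,V$ there is $n>0$ with $T^n(U)\cap V\neq\emptyset$, and weakly mixing if $(X\times X,T\times T)$ is transitive. Dimension means topological (covering) dimension. *)

theory Defs
  imports "HOL-Analysis.Analysis"
begin

definition covering_dim_le :: "'a topology \<Rightarrow> nat \<Rightarrow> bool" where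
  "covering_dim_le X n \<longleftrightarrow>
     (\<forall>\<U>. finite \<U> \<and> (\<forall>U\<in>\<U>. openin X U) \<and> \<Union>\<U> = topspace X \<longrightarrow>
        (\<exists>\<V>. finite \<V> \<and> (\<forall>V\<in>\<V>. openin X V) \<and> \<Union>\<V> = topspace X \<and>
             (\<forall>V\<in>\<V>. \<exists>U\<in>\<U>. V \<subseteq> U) \<and>
             (\<forall>x\<in>topspace X. card {V\<in>\<V>. x \<in> V} \<le> n + 1)))"

definition covering_dim_eq :: "'a topology \<Rightarrow> nat \<Rightarrow> bool" where
  "covering_dim_eq X n \<longleftrightarrow> covering_dim_le X n \<and> (n = 0 \<or> \<not> covering_dim_le X (n - 1))"

definition top_transitive :: "'a topology \<Rightarrow> ('a \<Rightarrow> 'a) \<Rightarrow> bool" where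
  "top_transitive X f \<longleftrightarrow>
     (\<forall>U V. openin X U \<and> openin X V \<and> U \<noteq> {} \<and> V \<noteq> {} \<longrightarrow>
        (\<exists>n>0. (f ^^ n) ` U \<inter> V \<noteq> {}))"

definition weakly_mixing :: "'a topology \<Rightarrow> ('a \<Rightarrow> 'a) \<Rightarrow> bool" where
  "weakly_mixing X f \<longleftrightarrow> top_transitive (prod_topology X X) (\<lambda>(x, y). (f x, f y))"

definition proximal_pair :: "'a metric \<Rightarrow> ('a \<Rightarrow> 'a) \<Rightarrow> 'a \<Rightarrow> 'a \<Rightarrow> bool" where
  "proximal_pair m T x y \<longleftrightarrow>
     (\<forall>e>0. \<forall>N. \<exists>n\<ge>N. mdist m ((T ^^ n) x) ((T ^^ n) y) < e)"

definition asymptotic_pair :: "'a metric \<Rightarrow> ('a \<Rightarrow> 'a) \<Rightarrow> 'a \<Rightarrow> 'a \<Rightarrow> bool" where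
  "asymptotic_pair m T x y \<longleftrightarrow>
     (\<forall>e>0. \<exists>N. \<forall>n\<ge>N. mdist m ((T ^^ n) x) ((T ^^ n) y) < e)"

definition li_yorke_pair :: "'a metric \<Rightarrow> ('a \<Rightarrow> 'a) \<Rightarrow> 'a \<Rightarrow> 'a \<Rightarrow> bool" where
  "li_yorke_pair m T x y \<longleftrightarrow> proximal_pair m T x y \<and> \<not> asymptotic_pair m T x y"

definition completely_scrambled :: "'a metric \<Rightarrow> ('a \<Rightarrow> 'a) \<Rightarrow> bool" where
  "completely_scrambled m T \<longleftrightarrow>
     (\<forall>x\<in>mspace m. \<forall>y\<in>mspace m. x \<noteq> y \<longrightarrow> li_yorke_pair m T x y)"

end

theory Submission
  imports Defs
begin

text \<open>The space is an inverse limit of finite wedges of \<open>n\<close>-cubes, realised as a shift space of block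
  placements. A block of level \<open>k + 1\<close> contains blocks of level \<open>k\<close>, each with an amplitude
  in \<open>[0,1]\<^sup>n\<close> that multiplies coordinatewise through the levels. Inside a block the amplitude
  varies slowly along a path that is nearly dense in the cube, so the shift by the length of a
  level \<open>k\<close> block is uniformly close to the identity: distinct points are not asymptotic. Most
  of each block is empty, so two points always spend a common time near the zero configuration,
  which makes every pair proximal. The path is repeated at offsets with distinct successive gaps,
  which gives weak mixing. Near a nonzero point the space is a
  zero-dimensional set times a cube: pulling back the star cover of the Freudenthal triangulation
  bounds the dimension by \<open>n\<close>, and an embedded copy of the cube, with Sperner's lemma, shows
  that it is not smaller.\<close>

section \<open>Blocks\<close>

text \<open>The requirements pull against each other. Rigidity along the times \<open>h k\<close>
  rules out asymptotic pairs, but it forces a block seen at one place to recur \<open>h k\<close>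
  later almost unchanged, so a block that is simply present or absent could never start or stop.
  Amplitudes resolve this: blocks fade in from zero and out to zero, and letting the amplitude fill
  a cube makes the same device produce the dimension. The level \<open>k\<close> data in a window of
  length \<open>h k\<close> are then one position and one amplitude, with all positions identified
  at amplitude zero; this is where the wedges come from. Amplitude factors lie in
  \<open>[0,1]\<close>, so passing to lower levels never increases sup distances, and every metric
  estimate can be made at one high level. The \<open>8\<close> in \<open>h (Suc k) = 8 * W k\<close>
  surrounds the active part of a block, of length \<open>W k\<close>, by gaps of several
  \<open>W k\<close>: a window around the origin sees one parent only, and among three times spaced
  by \<open>W k\<close> any two points share an empty one.\<close>

definition zigzag :: "nat \<Rightarrow> nat \<Rightarrow> nat" where
  "zigzag R u = min (u mod (2 * R)) (2 * R - u mod (2 * R))"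

lemma zigzag_le: "zigzag R u \<le> R"
  unfolding zigzag_def by linarith

lemma zigzag_eq: "v \<le> R \<Longrightarrow> u mod (2 * R) = v \<Longrightarrow> zigzag R u = v"
  unfolding zigzag_def by linarith

text \<open>\<open>zigzag R\<close> is the triangle wave of period \<open>2 * R\<close>. The case
  split isolates the end of a period, where the wave has come down to \<open>1\<close> and returns
  to \<open>0\<close>.\<close>

lemma zigzag_Suc:
  assumes "R \<ge> 1"
  shows "\<bar>real (zigzag R (Suc u)) - real (zigzag R u)\<bar> \<le> 1"
proof (cases "Suc (u mod (2 * R)) = 2 * R")
  case True
  then have "Suc u mod (2 * R) = 0" by (simp add: mod_Suc)
  with True show ?thesis unfolding zigzag_def by linarith
next
  case False
  then have "Suc u mod (2 * R) = Suc (u mod (2 * R))" by (simp add: mod_Suc)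
  moreover have "u mod (2 * R) < 2 * R" using assms by simp
  ultimately show ?thesis unfolding zigzag_def by (auto simp: min_def)
qed

text \<open>The top digit is added last, as \<open>v n * B ^ n\<close>; for \<open>i < n\<close>
  this is a multiple of \<open>B ^ (i + 1)\<close> and leaves digit \<open>i\<close>
  unchanged.\<close>

lemma exists_digits:
  fixes B :: nat
  assumes "B \<ge> 1" "\<And>i. i < n \<Longrightarrow> v i < B"
  shows "\<exists>t<B ^ n. \<forall>i<n. (t div B ^ i) mod B = v i"
  using assms(2)
proof (induction n)
  case 0
  then show ?case by simp
next
  case (Suc n)
  then obtain t where t: "t < B ^ n" "\<forall>i<n. (t div B ^ i) mod B = v i" by force
  have pos: "B ^ i > 0" for i using assms(1) by simp
  have "t + v n * B ^ n < B ^ n + v n * B ^ n" using t by simp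
  also have "\<dots> = (v n + 1) * B ^ n" by simp
  also have "\<dots> \<le> B * B ^ n" using Suc.prems[of n] by (intro mult_right_mono) auto
  finally have "t + v n * B ^ n < B ^ Suc n" by simp
  moreover have "((t + v n * B ^ n) div B ^ i) mod B = v i" if "i < Suc n" for i
  proof (cases "i = n")
    case True
    then show ?thesis using t(1) Suc.prems[of n] pos[of n] by simp
  next
    case False
    with that have i: "i < n" by simp
    then have "B ^ n = B ^ i * (B * B ^ (n - Suc i))"
      by (metis Suc_diff_Suc add_diff_inverse_nat less_imp_le_nat not_less power_Suc power_add)
    then have "(t + v n * B ^ n) div B ^ i = (t + (v n * (B * B ^ (n - Suc i))) * B ^ i) div B ^ i"
      by (simp add: mult_ac)
    also have "\<dots> = t div B ^ i + v n * (B * B ^ (n - Suc i))"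
      using pos[of i] by simp
    also have "\<dots> mod B = t div B ^ i mod B"
      by (simp add: mult.left_commute[of "v n"])
    finally show ?thesis using t(2) i by simp
  qed
  ultimately show ?case by blast
qed

lemma div_Suc_cases: "Suc t div m = t div m \<or> Suc t div m = Suc (t div m)"
  for t m :: nat
  by (simp add: div_Suc)

text \<open>Coordinate \<open>i\<close> of the path at time \<open>t\<close> is the zigzag of \<open>t div (2 R)^i\<close>: it
  moves by at most \<open>1/R\<close> per step, and the base \<open>2 R\<close> digits of \<open>t\<close> prescribe all coordinates
  independently.\<close>

lemma exists_sweep:
  fixes e :: real
  assumes "e > 0"
  shows "\<exists>(T::nat) (c :: nat \<Rightarrow> nat \<Rightarrow> real).
     (\<forall>t i. 0 \<le> c t i \<and> c t i \<le> 1) \<and>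
     (\<forall>t i. c t i \<noteq> 0 \<longrightarrow> 0 < t \<and> t < T \<and> i < n) \<and>
     (\<forall>t i. \<bar>c (Suc t) i - c t i\<bar> \<le> e) \<and>
     (\<exists>t<T. \<forall>i<n. c t i = 1) \<and>
     (\<forall>a. (\<forall>i<n. 0 \<le> a i \<and> a i \<le> 1) \<longrightarrow> (\<exists>t<T. \<forall>i<n. \<bar>c t i - a i\<bar> \<le> e))"
proof -
  obtain R0 :: nat where "1 / e < real R0" using reals_Archimedean2 by blast
  then obtain R :: nat where R: "R \<ge> 1" "1 / real R \<le> e"
    using assms by (intro that[of "Suc R0"]) (auto simp: field_simps)
  define B where "B = 2 * R"
  define T where "T = B ^ n"
  define c where "c t i = (if i < n \<and> t < T then real (zigzag R (t div B ^ i)) / real R else 0)" for t i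
  have B: "B \<ge> 1" "B > 0" using R by (auto simp: B_def)
  have c01: "0 \<le> c t i \<and> c t i \<le> 1" for t i
    using zigzag_le[of R "t div B ^ i"] R by (auto simp: c_def divide_le_eq)
  have c0: "c t i \<noteq> 0 \<longrightarrow> 0 < t \<and> t < T \<and> i < n" for t i
    by (cases "t = 0") (auto simp: c_def zigzag_def)
  have step: "\<bar>c (Suc t) i - c t i\<bar> \<le> e" for t i
  proof (cases "i < n \<and> t < T")
    case True
    define u where "u = t div B ^ i"
    have "c (Suc t) i = real (zigzag R (Suc t div B ^ i)) / real R"
    proof (cases "Suc t < T")
      case False
      \<comment> \<open>\<open>T = B ^ n\<close> is a multiple of \<open>B ^ (i + 1)\<close>, so at
        time \<open>T\<close> every wave is at the start of a period: cutting the path off to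
        \<open>0\<close> there causes no jump.\<close>
      with True have "Suc t = T" by simp
      moreover have "T = B ^ i * (B * B ^ (n - Suc i))" unfolding T_def
        using True by (metis Suc_diff_Suc add_diff_inverse_nat less_imp_le_nat not_less power_Suc power_add)
      ultimately have "Suc t div B ^ i mod B = 0" using B by simp
      then have "zigzag R (Suc t div B ^ i) = 0" unfolding zigzag_def B_def by simp
      with False show ?thesis by (simp add: c_def)
    qed (use True in \<open>simp add: c_def\<close>)
    moreover have "c t i = real (zigzag R u) / real R" using True by (simp add: c_def u_def)
    moreover have "\<bar>real (zigzag R (Suc t div B ^ i)) - real (zigzag R u)\<bar> \<le> 1"
      using div_Suc_cases[of t "B ^ i"] zigzag_Suc[OF R(1), of u] by (auto simp: u_def)
    ultimately have "\<bar>c (Suc t) i - c t i\<bar> \<le> 1 / real R"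
      by (simp add: diff_divide_distrib[symmetric] divide_right_mono)
    then show ?thesis using R by linarith
  next
    case False
    then show ?thesis using assms by (auto simp: c_def)
  qed
  \<comment> \<open>Digits at most \<open>R\<close> lie on the rising half of the wave, where it is
    the identity.\<close>
  have grid: "\<exists>t<T. \<forall>i<n. c t i = real (v i) / real R" if "\<And>i. i < n \<Longrightarrow> v i \<le> R" for v
  proof -
    have "v i < B" if "i < n" for i using \<open>i < n \<Longrightarrow> v i \<le> R\<close> that R by (simp add: B_def)
    then have "\<exists>t<T. \<forall>i<n. (t div B ^ i) mod B = v i"
      unfolding T_def using B(1) by (intro exists_digits) auto
    then obtain t where t: "t < T" "\<forall>i<n. (t div B ^ i) mod B = v i" by auto
    then have "\<forall>i<n. c t i = real (v i) / real R"
      using that by (auto simp: c_def B_def zigzag_eq)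
    with t show ?thesis by blast
  qed
  have one: "\<exists>t<T. \<forall>i<n. c t i = 1" using grid[of "\<lambda>_. R"] R by auto
  have dense: "\<exists>t<T. \<forall>i<n. \<bar>c t i - a i\<bar> \<le> e" if a: "\<forall>i<n. 0 \<le> a i \<and> a i \<le> 1" for a
  proof -
    define v where "v i = nat \<lfloor>a i * real R\<rfloor>" for i
    have v: "real (v i) \<le> a i * real R" "a i * real R < real (v i) + 1" if "i < n" for i
      using a that unfolding v_def by (auto simp: of_nat_nat) 
    have "v i \<le> R" if "i < n" for i
    proof -
      have "a i * real R \<le> 1 * real R" using a that by (intro mult_right_mono) auto
      then show ?thesis using v(1)[OF that] by linarith
    qed
    then obtain t where t: "t < T" "\<forall>i<n. c t i = real (v i) / real R" using grid by blast
    have "\<bar>c t i - a i\<bar> \<le> e" if "i < n" for i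
    proof -
      have "\<bar>c t i - a i\<bar> = \<bar>real (v i) - a i * real R\<bar> / real R"
      proof -
        have "c t i - a i = (real (v i) - a i * real R) / real R"
          using t that R by (simp add: field_simps)
        then show ?thesis by (simp add: abs_divide)
      qed
      also have "\<dots> \<le> 1 / real R" using v[OF that] by (intro divide_right_mono) auto
      finally show ?thesis using R by linarith
    qed
    with t show ?thesis by blast
  qed
  show ?thesis
    using c01 c0 step one dense by (intro exI[of _ T] exI[of _ c]) blast
qed

section \<open>Blocks made of repeated slow sweeps\<close>

definition approximates :: "nat \<Rightarrow> int \<Rightarrow> real \<Rightarrow> int \<Rightarrow> (int \<Rightarrow> nat \<Rightarrow> real) \<Rightarrow> int \<Rightarrow> (nat \<Rightarrow> real) \<Rightarrow> bool" where
  "approximates n h e W g d a \<longleftrightarrow>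
     W \<le> d \<and> d \<le> 2 * W \<and> (\<forall>i<n. \<bar>g d i - a i\<bar> \<le> e) \<and>
     (\<forall>d' i. d' \<noteq> d \<and> \<bar>d' - d\<bar> < h \<longrightarrow> g d' i = 0)"

definition slow_block :: "nat \<Rightarrow> int \<Rightarrow> real \<Rightarrow> int \<Rightarrow> (int \<Rightarrow> nat \<Rightarrow> real) \<Rightarrow> bool" where
  "slow_block n h e W g \<longleftrightarrow> 4 * h \<le> W \<and>
     (\<forall>d i. 0 \<le> g d i \<and> g d i \<le> 1) \<and>
     (\<forall>d i. g d i \<noteq> 0 \<longrightarrow> i < n \<and> W \<le> d \<and> d \<le> 2 * W - h) \<and>
     (\<forall>d i d' i'. g d i \<noteq> 0 \<and> g d' i' \<noteq> 0 \<and> d \<noteq> d' \<longrightarrow> h \<le> \<bar>d - d'\<bar>) \<and>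
     (\<forall>d i. \<bar>g (d + h) i - g d i\<bar> \<le> e) \<and>
     (\<exists>d. W \<le> d \<and> d \<le> 2 * W \<and> (\<forall>i<n. g d i = 1))"

text \<open>The free \<open>m\<close> absorbs the positions of four targets in their windows of
  length \<open>h\<close>; a difference of two position differences is at most \<open>2 * h\<close>.
  The last clause of \<open>approximates\<close> isolates the start at \<open>d\<close>, so that a
  window around it shows one start and nothing else.\<close>

definition mixing_block :: "nat \<Rightarrow> int \<Rightarrow> real \<Rightarrow> int \<Rightarrow> (int \<Rightarrow> nat \<Rightarrow> real) \<Rightarrow> bool" where
  "mixing_block n h e W g \<longleftrightarrow>
     (\<forall>m a1 a2 a3 a4. \<bar>m\<bar> \<le> 2 * h \<and>
        (\<forall>i<n. 0 \<le> a1 i \<and> a1 i \<le> 1) \<and> (\<forall>i<n. 0 \<le> a2 i \<and> a2 i \<le> 1) \<and>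
        (\<forall>i<n. 0 \<le> a3 i \<and> a3 i \<le> 1) \<and> (\<forall>i<n. 0 \<le> a4 i \<and> a4 i \<le> 1) \<longrightarrow>
        (\<exists>d1 d2 d3 d4. d1 + h < d2 \<and> d4 - d3 = d2 - d1 + m \<and>
           approximates n h e W g d1 a1 \<and> approximates n h e W g d2 a2 \<and>
           approximates n h e W g d3 a3 \<and> approximates n h e W g d4 a4))"

text \<open>The block repeats one slow sweep through the cube at offsets \<open>offs j\<close>. The successive gaps
  \<open>offs (j + 1) - offs j = L + j\<close> are pairwise distinct, so differences of offsets absorb any shift \<open>m\<close>.\<close>

lemma exists_block:
  fixes h :: int and e :: real
  assumes h: "h \<ge> 1" and e: "e > 0"
  shows "\<exists>W g. slow_block n h e W g \<and> mixing_block n h e W g"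
proof -
  obtain T :: nat and c :: "nat \<Rightarrow> nat \<Rightarrow> real" where
    c01: "\<And>t i. 0 \<le> c t i \<and> c t i \<le> 1" and
    c0: "\<And>t i. c t i \<noteq> 0 \<Longrightarrow> 0 < t \<and> t < T \<and> i < n" and
    cstep: "\<And>t i. \<bar>c (Suc t) i - c t i\<bar> \<le> e" and
    cone: "\<exists>t<T. \<forall>i<n. c t i = 1" and
    cdense: "\<And>a. (\<forall>i<n. 0 \<le> a i \<and> a i \<le> 1) \<Longrightarrow> (\<exists>t<T. \<forall>i<n. \<bar>c t i - a i\<bar> \<le> e)"
    using exists_sweep[OF e, of n] by metis
  \<comment> \<open>One sweep, with starts at multiples of \<open>h\<close>, has length
    \<open>H\<close>; spacing copies by at least \<open>L = H + h\<close> keeps them disjoint with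
    room to spare.\<close>
  define H where "H = int T * h"
  define L where "L = H + h"
  \<comment> \<open>\<open>E\<close> bounds the index correction \<open>s\<close> used for mixing,
    in either direction. Indices up to \<open>J = 2 * E + 1\<close> make both \<open>E + s\<close>
    and its successor available.\<close>
  define E where "E = nat (2 * h + 2 * H)"
  define J where "J = 2 * E + 1"
  define offs where "offs j = (\<Sum>q<j. L + int q)" for j :: nat
  define W where "W = 4 * h + offs J + H + h"
  define p where "p x i = (if h dvd x \<and> 0 \<le> x then c (nat (x div h)) i else 0)" for x i
  define g where "g d i = (\<Sum>j\<le>J. p (d - W - offs j) i)" for d i
  have H0: "H \<ge> 0" using h by (simp add: H_def)
  have L: "L \<ge> h" "L = H + h" using H0 by (auto simp: L_def)
  have offs_mono: "offs j + L \<le> offs j'" if "j < j'" for j j'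
  proof -
    have "offs j + L \<le> offs (Suc j)" by (simp add: offs_def)
    also have "offs (Suc j) \<le> offs j'" unfolding offs_def
      using that L h by (intro sum_mono2) auto
    finally show ?thesis .
  qed
  have offs0: "offs j \<ge> 0" for j unfolding offs_def using L h by (intro sum_nonneg) auto
  have offsJ: "offs j \<le> offs J" if "j \<le> J" for j
  proof (cases "j = J")
    case False
    then have "offs j + L \<le> offs J" using that by (intro offs_mono) auto
    with L(1) h show ?thesis by linarith
  qed simp
  have p01: "0 \<le> p x i \<and> p x i \<le> 1" for x i using c01 by (auto simp: p_def)
  have p0: "h \<le> x \<and> x \<le> H - h \<and> i < n \<and> h dvd x" if "p x i \<noteq> 0" for x i
  proof -
    have x: "h dvd x" "0 \<le> x" "c (nat (x div h)) i \<noteq> 0" using that by (auto simp: p_def split: if_splits)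
    then obtain t where t: "x = h * t" by blast
    then have tt: "x div h = t" "0 \<le> t" using h x by (auto simp: zero_le_mult_iff)
    then have "0 < t" "t + 1 \<le> int T" "i < n" using c0[OF x(3)] by auto
    then have "h * 1 \<le> h * t" "h * (t + 1) \<le> h * int T" using h by (intro mult_left_mono; simp)+
    then show ?thesis using x \<open>i < n\<close> t by (auto simp: algebra_simps H_def)
  qed
  \<comment> \<open>On the window of copy \<open>j\<close> the spacing \<open>L\<close> pushes the
    arguments of all other copies outside the range from \<open>h\<close> to \<open>H - h\<close>,
    where alone \<open>p\<close> can be nonzero.\<close>
  have gwin: "g d i = p (d - W - offs j) i"
    if "j \<le> J" "- h < d - W - offs j" "d - W - offs j \<le> H" for d i j
  proof -
    have "p (d - W - offs j') i = 0" if "j' \<noteq> j" for j'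
    proof (rule ccontr)
      assume "p (d - W - offs j') i \<noteq> 0"
      from p0[OF this] show False
        using offs_mono[of j j'] offs_mono[of j' j] that L h \<open>- h < d - W - offs j\<close>
          \<open>d - W - offs j \<le> H\<close>
        by (cases "j < j'") auto
    qed
    then have "g d i = (\<Sum>j'\<in>{j}. p (d - W - offs j') i)"
      unfolding g_def using \<open>j \<le> J\<close> by (intro sum.mono_neutral_right) auto
    then show ?thesis by simp
  qed
  have gnz: "\<exists>j\<le>J. h \<le> d - W - offs j \<and> d - W - offs j \<le> H - h \<and> h dvd d - W - offs j \<and> i < n"
    if nz: "g d i \<noteq> 0" for d i
  proof -
    obtain j where "j \<le> J" "p (d - W - offs j) i \<noteq> 0"
      using nz unfolding g_def by (metis (no_types, lifting) atMost_iff sum.neutral)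
    with p0 show ?thesis by blast
  qed
  have gval: "g (W + offs j + int t * h) i = c t i" if "j \<le> J" "t < T" for j t i
  proof -
    have th: "0 \<le> int t * h" "int t * h \<le> H" using that h by (auto simp: H_def intro: mult_right_mono)
    show ?thesis using gwin[OF that(1), of "W + offs j + int t * h" i] h th by (simp add: p_def)
  qed
  have gapp: "approximates n h e W g (W + offs j + int t * h) a"
    if "j \<le> J" "t < T" "\<forall>i<n. \<bar>c t i - a i\<bar> \<le> e" for j t a
      proof -
    define x where "x = int t * h"
    have th: "0 \<le> x" "x \<le> H - h"
    proof -
      have "(int t + 1) * h \<le> H" unfolding H_def using that h by (intro mult_right_mono) auto
      then show "x \<le> H - h" by (simp add: algebra_simps H_def x_def)
    qed (use h in \<open>auto simp: x_def\<close>)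
    show ?thesis unfolding approximates_def x_def[symmetric]
    proof (intro conjI allI impI)
    show "W \<le> W + offs j + x" using offs0 th by simp
    show "W + offs j + x \<le> 2 * W" 

    proof -
      have "offs j + x \<le> offs J + H" using offsJ[OF that(1)] th h by (smt (verit))
      moreover have "offs J \<ge> 0" "H \<ge> 0" using offs0 H0 by auto
      ultimately show ?thesis using h unfolding W_def by (smt (verit))
    qed
    show "\<bar>g (W + offs j + x) i - a i\<bar> \<le> e" if "i < n" for i
      using gval[OF \<open>j \<le> J\<close> \<open>t < T\<close>, folded x_def] \<open>\<forall>i<n. \<bar>c t i - a i\<bar> \<le> e\<close> that by simp
    fix d' i assume d': "d' \<noteq> W + offs j + x \<and> \<bar>d' - (W + offs j + x)\<bar> < h"
    then have "g d' i = p (d' - W - offs j) i" using th by (intro gwin that(1)) auto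
    also have "\<dots> = 0"
    proof -
      have "\<not> h dvd (d' - W - offs j)"
      proof
        assume "h dvd d' - W - offs j"
        then have "h dvd (d' - W - offs j) - x" by (simp add: x_def)
        moreover have "(d' - W - offs j) - x \<noteq> 0" using d' by auto
        ultimately have "\<bar>h\<bar> \<le> \<bar>(d' - W - offs j) - x\<bar>" by (rule dvd_imp_le_int[rotated])
        with d' h show False by auto
      qed
      then show ?thesis by (simp add: p_def)
    qed
    finally show "g d' i = 0" .
  qed
  qed
  have P1: "0 \<le> g d i \<and> g d i \<le> 1" for d i
  proof (cases "g d i = 0")
    case False
    from gnz[OF this] obtain j where "j \<le> J" "h \<le> d - W - offs j" "d - W - offs j \<le> H - h" by blast
    with gwin[of j d i] h p01[of "d - W - offs j" i] show ?thesis by simp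
  qed simp
  have P2: "i < n \<and> W \<le> d \<and> d \<le> 2 * W - h" if "g d i \<noteq> 0" for d i
  proof -
    from gnz[OF that] obtain j where "j \<le> J" "h \<le> d - W - offs j" "d - W - offs j \<le> H - h" "i < n" by blast
    with offs0[of j] offsJ[of j] h show ?thesis unfolding W_def by auto
  qed
  have P3: "h \<le> \<bar>d - d'\<bar>" if "g d i \<noteq> 0" "g d' i' \<noteq> 0" "d \<noteq> d'" for d i d' i'
  proof (rule ccontr)
    assume n: "\<not> h \<le> \<bar>d - d'\<bar>"
    from gnz[OF that(1)] obtain j where j: "j \<le> J" "h \<le> d - W - offs j" "d - W - offs j \<le> H - h"
      "h dvd d - W - offs j" by blast
    then have "g d' i' = p (d' - W - offs j) i'" using n by (intro gwin) auto
    with that have "h dvd d' - W - offs j" using p0[of "d' - W - offs j" i'] by auto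
    with j(4) have "h dvd (d - W - offs j) - (d' - W - offs j)" by (rule dvd_diff)
    then have "h dvd d - d'" by simp
    then have "\<bar>h\<bar> \<le> \<bar>d - d'\<bar>" using that by (intro dvd_imp_le_int) auto
    with n h show False by simp
  qed
  have P4: "\<bar>g (d + h) i - g d i\<bar> \<le> e" for d i
  proof (cases "g d i = 0 \<and> g (d + h) i = 0")
    case True
    then show ?thesis using e by simp
  next
    case False
    \<comment> \<open>Whichever of the two values is nonzero selects a copy whose window contains
      both \<open>d\<close> and \<open>d + h\<close>.\<close>
    then obtain j where j: "j \<le> J" "0 \<le> d - W - offs j" "d - W - offs j \<le> H - h"
    proof (cases "g d i = 0")
      case True
      with False have "g (d + h) i \<noteq> 0" by simp
      from gnz[OF this] obtain j where "j \<le> J" "h \<le> d + h - W - offs j" "d + h - W - offs j \<le> H - h" by blast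
      then show ?thesis using h by (intro that) auto
    next
      case False
      from gnz[OF this] obtain j where "j \<le> J" "h \<le> d - W - offs j" "d - W - offs j \<le> H - h" by blast
      then show ?thesis using h by (intro that) auto
    qed
    define x where "x = d - W - offs j"
    have "g d i = p x i" unfolding x_def using j h by (intro gwin) auto
    moreover have "g (d + h) i = p (d + h - W - offs j) i" using j h by (intro gwin) auto
    moreover have "d + h - W - offs j = x + h" by (simp add: x_def)
    moreover have "\<bar>p (x + h) i - p x i\<bar> \<le> e"
    proof (cases "h dvd x")
      case True
      have "0 \<le> x div h" using j h by (simp add: x_def pos_imp_zdiv_nonneg_iff)
      then have "nat ((x + h) div h) = Suc (nat (x div h))" using h by (simp add: nat_add_distrib)
      then show ?thesis using cstep[of "nat (x div h)" i] True j h by (simp add: p_def x_def)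
    next
      case False
      then show ?thesis using e by (simp add: p_def)
    qed
    ultimately show ?thesis by simp
  qed
  have P5: "\<exists>d. W \<le> d \<and> d \<le> 2 * W \<and> (\<forall>i<n. g d i = 1)"
  proof -
    from cone obtain t where t: "t < T" "\<forall>i<n. c t i = 1" by blast
    then have "approximates n h e W g (W + offs 0 + int t * h) (\<lambda>_. 1)" using e by (intro gapp) auto
    with t gval[of 0 t] show ?thesis
      by (intro exI[of _ "W + offs 0 + int t * h"]) (auto simp: approximates_def)
  qed
  have P6: "\<exists>d1 d2 d3 d4. d1 + h < d2 \<and> d4 - d3 = d2 - d1 + m \<and>
           approximates n h e W g d1 a1 \<and> approximates n h e W g d2 a2 \<and>
           approximates n h e W g d3 a3 \<and> approximates n h e W g d4 a4"
    if m: "\<bar>m\<bar> \<le> 2 * h" and a: "\<forall>i<n. 0 \<le> a1 i \<and> a1 i \<le> 1" "\<forall>i<n. 0 \<le> a2 i \<and> a2 i \<le> 1"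
       "\<forall>i<n. 0 \<le> a3 i \<and> a3 i \<le> 1" "\<forall>i<n. 0 \<le> a4 i \<and> a4 i \<le> 1" for m and a1 a2 a3 a4 :: "nat \<Rightarrow> real"
  proof -
    obtain t1 t2 t3 t4 where t: "t1 < T" "t2 < T" "t3 < T" "t4 < T"
      "\<forall>i<n. \<bar>c t1 i - a1 i\<bar> \<le> e" "\<forall>i<n. \<bar>c t2 i - a2 i\<bar> \<le> e"
      "\<forall>i<n. \<bar>c t3 i - a3 i\<bar> \<le> e" "\<forall>i<n. \<bar>c t4 i - a4 i\<bar> \<le> e"
      using cdense[OF a(1)] cdense[OF a(2)] cdense[OF a(3)] cdense[OF a(4)] by blast
    define x where "x t = int t * h" for t
    have th: "0 \<le> x t \<and> x t \<le> H" if "t < T" for t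
      unfolding x_def using that h by (auto simp: H_def intro: mult_right_mono)
    note th4 = th[OF t(1)] th[OF t(2)] th[OF t(3)] th[OF t(4)]
    \<comment> \<open>Gaps grow by one from copy to copy, so moving from copies \<open>E\<close>,
      \<open>E + 1\<close> to copies \<open>E + s\<close>, \<open>E + s + 1\<close> changes the gap
      by exactly \<open>s\<close>. This \<open>s\<close> makes up for \<open>m\<close> and for the
      different times within the sweeps.\<close>
    define s where "s = m + (x t2 - x t1) - (x t4 - x t3)"
    have E: "int E = 2 * h + 2 * H" using h H0 by (simp add: E_def)
    have s: "\<bar>s\<bar> \<le> int E" unfolding E s_def using m th4 by linarith
    define j where "j = nat (int E + s)"
    have j: "int j = int E + s" "j \<le> 2 * E" using s by (auto simp: j_def)
    define d where "d q t = W + offs q + x t" for q t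
    have Suc: "offs (Suc q) = offs q + L + int q" for q by (simp add: offs_def)
    have "d E t1 + h < d (Suc E) t2" unfolding d_def Suc using L th4 h E by simp
    moreover have "d (Suc j) t4 - d j t3 = d (Suc E) t2 - d E t1 + m"
      unfolding d_def Suc using j by (simp add: s_def algebra_simps)
    moreover have "approximates n h e W g (d E t1) a1" "approximates n h e W g (d (Suc E) t2) a2"
       "approximates n h e W g (d j t3) a3" "approximates n h e W g (d (Suc j) t4) a4"
      unfolding d_def x_def using t j by (auto intro!: gapp simp: J_def)
    ultimately show ?thesis by blast
  qed
  have "4 * h \<le> W" using offs0[of J] h H0 by (simp add: W_def)
  then have "slow_block n h e W g"
    unfolding slow_block_def using P1 P2 P3 P4 P5 by (intro conjI) (assumption | metis)+
  moreover have "mixing_block n h e W g"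
    unfolding mixing_block_def by (intro allI impI; elim conjE; rule P6; assumption)
  ultimately show ?thesis by blast
qed

section \<open>The shift space of a tower of blocks\<close>

type_synonym config = "nat \<times> int \<times> nat \<Rightarrow> real"

definition shift :: "config \<Rightarrow> config" where
  "shift z = (\<lambda>(k, j, i). z (k, j + 1, i))"

lemma shift_apply [simp]: "shift z (k, j, i) = z (k, j + 1, i)"
  by (simp add: shift_def)

lemma shift_funpow [simp]: "(shift ^^ m) z (k, j, i) = z (k, j + int m, i)"
  by (induction m arbitrary: j) (simp_all add: algebra_simps)

text \<open>\<open>z (k, j, i)\<close> is the \<open>i\<close>-th coordinate of the amplitude of the level \<open>k\<close> block that starts
  at position \<open>j\<close>, and \<open>0\<close> if there is none. Blocks of level \<open>k\<close> have length \<open>h k\<close>; the block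
  of level \<open>k + 1\<close> has length \<open>8 * W k\<close> and contains nontrivial level \<open>k\<close> blocks only in the part
  from \<open>W k\<close> to \<open>2 * W k\<close>.\<close>

locale tower =
  fixes n :: nat and h W :: "nat \<Rightarrow> int" and g :: "nat \<Rightarrow> int \<Rightarrow> nat \<Rightarrow> real"
  assumes h_0: "h 0 \<ge> 1" and h_Suc: "\<And>k. h (Suc k) = 8 * W k"
    and slow_block: "\<And>k. slow_block n (h k) ((1/2) ^ k) (W k) (g k)"
    and mixing_block: "\<And>k. mixing_block n (h k) ((1/2) ^ k) (W k) (g k)"
begin

lemma
  shows W_ge: "4 * h k \<le> W k"
    and g_nonneg: "0 \<le> g k d i"
    and g_le_1: "g k d i \<le> 1"
    and g_support: "g k d i \<noteq> 0 \<Longrightarrow> i < n \<and> W k \<le> d \<and> d \<le> 2 * W k - h k"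
    and g_separated: "g k d i \<noteq> 0 \<Longrightarrow> g k d' i' \<noteq> 0 \<Longrightarrow> d \<noteq> d' \<Longrightarrow> h k \<le> \<bar>d - d'\<bar>"
    and g_slow: "\<bar>g k (d + h k) i - g k d i\<bar> \<le> (1/2) ^ k"
    and g_full: "\<exists>d. W k \<le> d \<and> d \<le> 2 * W k \<and> (\<forall>i<n. g k d i = 1)"
proof -
  note b = slow_block[of k, unfolded slow_block_def]
  show "4 * h k \<le> W k" by (rule b[THEN conjunct1])
  show "0 \<le> g k d i" "g k d i \<le> 1"
    using b[THEN conjunct2, THEN conjunct1] by simp_all
  show "g k d i \<noteq> 0 \<Longrightarrow> i < n \<and> W k \<le> d \<and> d \<le> 2 * W k - h k"
    by (rule b[THEN conjunct2, THEN conjunct2, THEN conjunct1, rule_format])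
  show "g k d i \<noteq> 0 \<Longrightarrow> g k d' i' \<noteq> 0 \<Longrightarrow> d \<noteq> d' \<Longrightarrow> h k \<le> \<bar>d - d'\<bar>"
    by (rule b[THEN conjunct2, THEN conjunct2, THEN conjunct2, THEN conjunct1, rule_format]) auto
  show "\<bar>g k (d + h k) i - g k d i\<bar> \<le> (1/2) ^ k"
    by (rule b[THEN conjunct2, THEN conjunct2, THEN conjunct2, THEN conjunct2, THEN conjunct1, rule_format])
  show "\<exists>d. W k \<le> d \<and> d \<le> 2 * W k \<and> (\<forall>i<n. g k d i = 1)"
    by (rule b[THEN conjunct2, THEN conjunct2, THEN conjunct2, THEN conjunct2, THEN conjunct2])
qed

lemma g_mixing:
  assumes "\<bar>m\<bar> \<le> 2 * h k"
    and "\<forall>i<n. 0 \<le> a1 i \<and> a1 i \<le> 1" "\<forall>i<n. 0 \<le> a2 i \<and> a2 i \<le> 1"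
      "\<forall>i<n. 0 \<le> a3 i \<and> a3 i \<le> 1" "\<forall>i<n. 0 \<le> a4 i \<and> a4 i \<le> 1"
  shows "\<exists>d1 d2 d3 d4. d1 + h k < d2 \<and> d4 - d3 = d2 - d1 + m \<and>
           approximates n (h k) ((1/2) ^ k) (W k) (g k) d1 a1 \<and>
           approximates n (h k) ((1/2) ^ k) (W k) (g k) d2 a2 \<and>
           approximates n (h k) ((1/2) ^ k) (W k) (g k) d3 a3 \<and>
           approximates n (h k) ((1/2) ^ k) (W k) (g k) d4 a4"
proof -
  note * = mixing_block[of k, unfolded mixing_block_def]
  show ?thesis
    by (rule *[THEN spec, THEN spec, THEN spec, THEN spec, THEN spec, THEN mp]) (intro conjI assms)
qed

lemma h_ge: "int k + 1 \<le> h k"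
proof (induction k)
  case (Suc k)
  then show ?case using h_Suc[of k] W_ge[of k] by simp
qed (use h_0 in simp)

lemma h_pos: "0 < h k" and W_pos: "0 < W k"
  using h_ge[of k] W_ge[of k] by linarith+

section \<open>The configuration space and its compactness\<close>

definition bounded_at :: "nat \<Rightarrow> config \<Rightarrow> bool" where
  "bounded_at k z \<longleftrightarrow> (\<forall>j i. 0 \<le> z (k, j, i) \<and> z (k, j, i) \<le> 1 \<and> (n \<le> i \<longrightarrow> z (k, j, i) = 0))"

definition separated_at :: "nat \<Rightarrow> config \<Rightarrow> bool" where
  "separated_at k z \<longleftrightarrow>
     (\<forall>j i j' i'. z (k, j, i) \<noteq> 0 \<and> z (k, j', i') \<noteq> 0 \<and> j \<noteq> j' \<longrightarrow> h k \<le> \<bar>j - j'\<bar>)"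

text \<open>Together the clauses say that an entry is the maximum of the products over possible
  parents. For entries separated at level \<open>Suc k\<close> at most one product is nonzero, so
  the maximum is just that product. Stated this way, with \<open>d\<close> in a finite range, the
  condition is closed.\<close>

definition refined_at :: "nat \<Rightarrow> config \<Rightarrow> bool" where
  "refined_at k z \<longleftrightarrow>
     (\<forall>j i d. z (Suc k, j - d, i) * g k d i \<le> z (k, j, i)) \<and>
     (\<forall>j i. \<exists>d\<in>{0..2 * W k}. z (k, j, i) = z (Suc k, j - d, i) * g k d i)"

definition Y :: "config set" where
  "Y = {z. \<forall>k. bounded_at k z \<and> separated_at k z \<and> refined_at k z}"

lemma
  assumes "z \<in> Y"
  shows Y_nonneg: "0 \<le> z (k, j, i)" and Y_le_1: "z (k, j, i) \<le> 1"
    and Y_out: "n \<le> i \<Longrightarrow> z (k, j, i) = 0"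
    and Y_separated: "z (k, j, i) \<noteq> 0 \<Longrightarrow> z (k, j', i') \<noteq> 0 \<Longrightarrow> j \<noteq> j' \<Longrightarrow> h k \<le> \<bar>j - j'\<bar>"
    and Y_ge: "z (Suc k, j - d, i) * g k d i \<le> z (k, j, i)"
    and Y_eq: "\<exists>d. z (k, j, i) = z (Suc k, j - d, i) * g k d i"
proof -
  have b: "bounded_at k z" and s: "separated_at k z" and r: "refined_at k z"
    using assms by (auto simp: Y_def)
  show "0 \<le> z (k, j, i)" "z (k, j, i) \<le> 1" "n \<le> i \<Longrightarrow> z (k, j, i) = 0"
    using b by (simp_all add: bounded_at_def)
  show "z (k, j, i) \<noteq> 0 \<Longrightarrow> z (k, j', i') \<noteq> 0 \<Longrightarrow> j \<noteq> j' \<Longrightarrow> h k \<le> \<bar>j - j'\<bar>"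
    by (rule s[unfolded separated_at_def, rule_format]) auto
  show "z (Suc k, j - d, i) * g k d i \<le> z (k, j, i)"
    using r by (simp add: refined_at_def)
  show "\<exists>d. z (k, j, i) = z (Suc k, j - d, i) * g k d i"
    using r unfolding refined_at_def by (metis (no_types))
qed

lemma Y_parent:
  assumes "z \<in> Y" "z (k, j, i) \<noteq> 0"
  shows "\<exists>d. z (k, j, i) = z (Suc k, j - d, i) * g k d i \<and> z (Suc k, j - d, i) \<noteq> 0 \<and>
           W k \<le> d \<and> d \<le> 2 * W k - h k"
proof -
  obtain d where d: "z (k, j, i) = z (Suc k, j - d, i) * g k d i" using Y_eq[OF assms(1)] by blast
  with assms(2) have "g k d i \<noteq> 0" "z (Suc k, j - d, i) \<noteq> 0" by auto
  with d g_support show ?thesis by blast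
qed

lemma continuous_config [continuous_intros]: "continuous_on UNIV (\<lambda>z :: config. z x)"
  by (rule continuous_on_product_coordinates)

lemma closed_bounded_at: "closed {z. bounded_at k z}"
  unfolding bounded_at_def
  by (intro closed_Collect_all closed_Collect_conj closed_Collect_imp closed_Collect_le
      closed_Collect_eq continuous_intros) (auto intro: open_Collect_const)

lemma closed_separated_at: "closed {z. separated_at k z}"
proof -
  \<comment> \<open>Nonvanishing is an open hypothesis; as the vanishing of a product it becomes a
    closed alternative.\<close>
  have "separated_at k z \<longleftrightarrow> (\<forall>j i j' i'. z (k, j, i) * z (k, j', i') = 0 \<or> j = j' \<or> h k \<le> \<bar>j - j'\<bar>)" for z
    unfolding separated_at_def by auto
  then show ?thesis
    by (simp only:) (intro closed_Collect_all closed_Collect_disj closed_Collect_eq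
      closed_Collect_const continuous_intros)
qed

lemma closed_refined_at: "closed {z. refined_at k z}"
proof -
  \<comment> \<open>The finite range of \<open>d\<close> turns the existential into a finite union
    of closed sets.\<close>
  have "closed (\<Union>d\<in>{0..2 * W k}. {z :: config. z (k, j, i) = z (Suc k, j - d, i) * g k d i})" for j i
    by (intro closed_UN finite_atLeastAtMost_int ballI closed_Collect_eq continuous_intros)
  then have "closed {z :: config. \<exists>d\<in>{0..2 * W k}. z (k, j, i) = z (Suc k, j - d, i) * g k d i}" for j i
    by (simp add: Collect_bex_eq)
  then show ?thesis
    unfolding refined_at_def
    by (intro closed_Collect_all closed_Collect_conj closed_Collect_le continuous_intros)
qed

definition hilbert_cube :: "config set" where
  "hilbert_cube = (\<Pi>\<^sub>E x\<in>UNIV. {0..1})"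

lemma compact_hilbert_cube: "compact hilbert_cube"
proof -
  have "compactin (product_topology (\<lambda>_. euclidean) UNIV) hilbert_cube"
    unfolding hilbert_cube_def compactin_PiE by simp
  then show ?thesis by (simp add: euclidean_product_topology)
qed

lemma bounded_in_hilbert_cube: "(\<And>k. bounded_at k z) \<Longrightarrow> z \<in> hilbert_cube"
  unfolding hilbert_cube_def bounded_at_def by auto

lemma closed_Y: "closed Y"
  unfolding Y_def
  by (intro closed_Collect_all closed_Collect_conj closed_bounded_at closed_separated_at closed_refined_at)

lemma compact_Y: "compact Y"
proof -
  have "Y = hilbert_cube \<inter> Y" using bounded_in_hilbert_cube by (auto simp: Y_def)
  then show ?thesis using compact_Int_closed[OF compact_hilbert_cube closed_Y] by simp
qed

section \<open>The shift as a bijection of the space\<close>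

lemma continuous_shift: "continuous_on UNIV shift"
  unfolding shift_def
proof (rule continuous_on_coordinatewise_then_product)
  fix x :: "nat \<times> int \<times> nat"
  show "continuous_on UNIV (\<lambda>z :: config. case x of (k, j, i) \<Rightarrow> z (k, j + 1, i))"
    by (cases x) (simp add: continuous_config)
qed

lemma Y_translate:
  assumes "z \<in> Y"
  shows "(\<lambda>(k, j, i). z (k, j + t, i)) \<in> Y"
proof -
  have "refined_at k (\<lambda>(k, j, i). z (k, j + t, i))" for k
    unfolding refined_at_def prod.case
  proof (intro conjI allI)
    fix j d i
    show "z (Suc k, j - d + t, i) * g k d i \<le> z (k, j + t, i)"
      using Y_ge[OF assms, of k "j + t" d i] by (simp add: algebra_simps)
    have "\<exists>d\<in>{0..2 * W k}. z (k, j + t, i) = z (Suc k, j + t - d, i) * g k d i"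
      using assms unfolding Y_def refined_at_def by blast
    then show "\<exists>d\<in>{0..2 * W k}. z (k, j + t, i) = z (Suc k, j - d + t, i) * g k d i"
      by (simp add: algebra_simps)
  qed
  moreover have "bounded_at k (\<lambda>(k, j, i). z (k, j + t, i))" for k
    using Y_nonneg[OF assms] Y_le_1[OF assms] Y_out[OF assms] by (simp add: bounded_at_def)
  moreover have "separated_at k (\<lambda>(k, j, i). z (k, j + t, i))" for k
    unfolding separated_at_def prod.case
    using Y_separated[OF assms] by (metis add_diff_cancel_right add_right_cancel)
  ultimately show ?thesis by (simp add: Y_def)
qed

lemma shift_Y: "z \<in> Y \<Longrightarrow> shift z \<in> Y"
  using Y_translate[of z 1] by (simp add: shift_def)

lemma shift_funpow_Y: "z \<in> Y \<Longrightarrow> (shift ^^ m) z \<in> Y"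
  by (induction m) (auto intro: shift_Y)

lemma shift_image_Y: "shift ` Y = Y"
proof
  show "Y \<subseteq> shift ` Y"
  proof
    fix z assume "z \<in> Y"
    then have "(\<lambda>(k, j, i). z (k, j + (- 1), i)) \<in> Y" by (rule Y_translate)
    moreover have "z = shift (\<lambda>(k, j, i). z (k, j + (- 1), i))" by (auto simp: shift_def)
    ultimately show "z \<in> shift ` Y" by (rule image_eqI[where f = shift, rotated])
  qed
qed (auto intro: shift_Y)

lemma inj_shift: "inj shift"
proof (rule injI)
  fix z w assume eq: "shift z = shift w"
  have "z (k, j, i) = w (k, j, i)" for k j i
    using fun_cong[OF eq, of "(k, j - 1, i)"] by simp
  then show "z = w" by auto
qed

text \<open>A maximum of higher entries multiplied by factors in \<open>[0,1]\<close> is 1-Lipschitz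
  for the sup norm. Factors vanish outside the active part, so only parents at offsets between
  \<open>W k\<close> and \<open>2 * W k\<close> have to be close.\<close>

lemma refine_lipschitz:
  assumes "z \<in> Y" "w \<in> Y" "0 \<le> e"
    and "\<And>d. W k \<le> d \<Longrightarrow> d \<le> 2 * W k \<Longrightarrow> \<bar>z (Suc k, j - d, i) - w (Suc k, j - d, i)\<bar> \<le> e"
  shows "\<bar>z (k, j, i) - w (k, j, i)\<bar> \<le> e"
proof -
  have *: "z (k, j, i) \<le> w (k, j, i) + e"
    if zw: "z \<in> Y" "w \<in> Y"
      and close: "\<And>d. W k \<le> d \<Longrightarrow> d \<le> 2 * W k \<Longrightarrow> \<bar>z (Suc k, j - d, i) - w (Suc k, j - d, i)\<bar> \<le> e" for z w
  proof (cases "z (k, j, i) = 0")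
    case True
    then show ?thesis using Y_nonneg[OF zw(2)] assms(3) by simp
  next
    case False
    then obtain d where d: "z (k, j, i) = z (Suc k, j - d, i) * g k d i" "W k \<le> d" "d \<le> 2 * W k - h k"
      using Y_parent[OF zw(1)] by blast
    have "z (k, j, i) \<le> (w (Suc k, j - d, i) + e) * g k d i"
      unfolding d(1) using close[of d] d h_pos[of k] g_nonneg by (intro mult_right_mono) auto
    also have "\<dots> \<le> w (Suc k, j - d, i) * g k d i + e * 1"
      unfolding distrib_right using g_le_1 assms(3) by (intro add_left_mono mult_left_mono) auto
    also have "\<dots> \<le> w (k, j, i) + e" using Y_ge[OF zw(2)] by simp
    finally show ?thesis .
  qed
  have "z (k, j, i) \<le> w (k, j, i) + e"
    by (rule *[OF assms(1,2)]) (rule assms(4))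
  moreover have "w (k, j, i) \<le> z (k, j, i) + e"
    by (rule *[OF assms(2,1)]) (subst abs_minus_commute, rule assms(4))
  ultimately show ?thesis by linarith
qed

text \<open>The wide empty margins of the blocks make everything of level at most \<open>K\<close> near the origin
  depend only on the level \<open>K + 1\<close> block that covers the origin.\<close>

lemma window_lipschitz:
  assumes "z \<in> Y" "w \<in> Y" "0 \<le> e" "l \<le> K"
    and close: "\<And>s i. - h (Suc K) < s \<Longrightarrow> s \<le> 0 \<Longrightarrow> \<bar>z (Suc K, s, i) - w (Suc K, s, i)\<bar> \<le> e"
    and "\<bar>j\<bar> \<le> 2 * h K"
  shows "\<bar>z (l, j, i) - w (l, j, i)\<bar> \<le> e"
proof -
  \<comment> \<open>The window is widened for the induction. Descending from \<open>Suc l\<close> to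
    \<open>l\<close> costs \<open>2 * W l\<close>, which the drop from
    \<open>2 * h (Suc l) = 16 * W l\<close> to \<open>2 * h l\<close> pays for. At
    \<open>l = K\<close> the radius is \<open>W K\<close>, the length of the empty front part of a
    block, so only parents starting at or before \<open>0\<close> matter.\<close>
  have "\<forall>j. \<bar>j\<bar> \<le> W K - 2 * h K + 2 * h l \<longrightarrow> \<bar>z (l, j, i) - w (l, j, i)\<bar> \<le> e"
    using assms(4)
  proof (induction l rule: inc_induct)
    case base
    show ?case
    proof (intro allI impI)
      fix j assume "\<bar>j\<bar> \<le> W K - 2 * h K + 2 * h K"
      then show "\<bar>z (K, j, i) - w (K, j, i)\<bar> \<le> e"
        using W_pos[of K] by (intro refine_lipschitz[OF assms(1-3), of K] close) (auto simp: h_Suc)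
    qed
  next
    case (step l)
    show ?case
    proof (intro allI impI)
      fix j assume "\<bar>j\<bar> \<le> W K - 2 * h K + 2 * h l"
      then show "\<bar>z (l, j, i) - w (l, j, i)\<bar> \<le> e"
        using W_pos[of l] W_ge[of l] h_pos[of l]
        by (intro refine_lipschitz[OF assms(1-3), of l] step.IH[rule_format]) (auto simp: h_Suc)
    qed
  qed
  then show ?thesis using assms(6) W_ge[of K] h_pos[of K] h_pos[of l] by auto
qed

text \<open>The product metric is at most twice the maximum over the first coordinates plus the tail
  \<open>(1/2) ^ N\<close>; hence the factor \<open>3\<close>.\<close>

lemma dist_config_bound:
  fixes e :: real
  assumes "e > 0"
  shows "\<exists>I. finite I \<and> (\<forall>z w :: config. (\<forall>x\<in>I. \<bar>z x - w x\<bar> \<le> e) \<longrightarrow> dist z w < 3 * e)"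
proof -
  obtain N :: nat where N: "(1/2) ^ N < e" using real_arch_pow_inv[OF assms, of "1/2"] by auto
  have "dist z w < 3 * e"
    if "\<forall>x\<in>from_nat ` {..N}. \<bar>z x - w x\<bar> \<le> e" for z w :: config
  proof -
    have "Max {dist (z (from_nat n)) (w (from_nat n)) | n. n \<le> N} \<le> e"
      using that by (intro Max.boundedI) (auto simp: dist_real_def)
    with N dist_fun_le_dist_first_terms[of z w N] show ?thesis by linarith
  qed
  then show ?thesis by (intro exI[of _ "from_nat ` {..N}"]) auto
qed

text \<open>Reduces metric questions to amplitudes at one level. \<open>K0\<close> exceeds every
  level and position among the finitely many coordinates that control the distance, so a window at
  level \<open>K\<close> determines them all.\<close>

lemma dist_lt_if_close:
  assumes "e > 0"
  shows "\<exists>K0. \<forall>K\<ge>K0. \<forall>z\<in>Y. \<forall>w\<in>Y.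
     (\<forall>s i. - h K < s \<and> s \<le> 0 \<and> i < n \<longrightarrow> \<bar>z (K, s, i) - w (K, s, i)\<bar> \<le> e) \<longrightarrow> dist z w < 3 * e"
proof -
  obtain I :: "(nat \<times> int \<times> nat) set" where I: "finite I"
    "\<And>z w :: config. (\<forall>x\<in>I. \<bar>z x - w x\<bar> \<le> e) \<Longrightarrow> dist z w < 3 * e"
    using dist_config_bound[OF assms] by blast
  define K0 where "K0 = Suc (\<Sum>(l, j, i)\<in>I. l + nat \<bar>j\<bar>)"
  have K0: "l + nat \<bar>j\<bar> < K0" if "(l, j, i) \<in> I" for l j i
    using member_le_sum[OF that, of "\<lambda>(l, j, i). l + nat \<bar>j\<bar>"] I(1) by (simp add: K0_def)
  have "dist z w < 3 * e" if "K \<ge> K0" "z \<in> Y" "w \<in> Y"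
    and close: "\<forall>s i. - h K < s \<and> s \<le> 0 \<and> i < n \<longrightarrow> \<bar>z (K, s, i) - w (K, s, i)\<bar> \<le> e" for K z w
  proof (rule I(2))
    obtain K' where K': "K = Suc K'" using \<open>K \<ge> K0\<close> by (cases K) (auto simp: K0_def)
    have close': "\<bar>z (Suc K', s, i) - w (Suc K', s, i)\<bar> \<le> e" if "- h (Suc K') < s" "s \<le> 0" for s i
      using close that assms Y_out[OF \<open>z \<in> Y\<close>, of i] Y_out[OF \<open>w \<in> Y\<close>, of i]
      by (cases "i < n") (auto simp: K')
    have "\<bar>z (l, j, i) - w (l, j, i)\<bar> \<le> e" if "(l, j, i) \<in> I" for l j i
    proof (rule window_lipschitz[OF \<open>z \<in> Y\<close> \<open>w \<in> Y\<close>])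
      show "l \<le> K'" using K0[OF that] \<open>K \<ge> K0\<close> K' by simp
      show "\<bar>j\<bar> \<le> 2 * h K'" using K0[OF that] \<open>K \<ge> K0\<close> K' h_ge[of K'] by linarith
    qed (use assms close' in auto)
    then show "\<forall>x\<in>I. \<bar>z x - w x\<bar> \<le> e" by auto
  qed
  then show ?thesis by blast
qed

lemma dist_config_coordinate:
  fixes e :: real
  assumes "e > 0"
  shows "\<exists>d>0. \<forall>z w :: config. dist z w < d \<longrightarrow> \<bar>z x - w x\<bar> < e"
proof -
  define c :: real where "c = (1/2) ^ to_nat x"
  have c: "c > 0" by (simp add: c_def)
  have "\<bar>z x - w x\<bar> < e" if "dist z w < c * min e 1" for z w :: config
  proof -
    have s: "summable (\<lambda>n. (1/2) ^ n * min (dist (z (from_nat n)) (w (from_nat n))) 1)"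
      by (rule summable_comparison_test'[of "\<lambda>n. (1/2) ^ n"]) (auto simp: summable_geometric_iff)
    have "c * min (dist (z x) (w x)) 1 \<le> dist z w"
      unfolding dist_fun_def c_def using sum_le_suminf[OF s, of "{to_nat x}"] by simp
    with that have "c * min (dist (z x) (w x)) 1 < c * min e 1" by simp
    then have "min (dist (z x) (w x)) 1 < min e 1" using c by simp
    then show ?thesis by (simp add: dist_real_def min_def split: if_splits)
  qed
  then show ?thesis using c assms by (intro exI[of _ "c * min e 1"]) auto
qed

subsection \<open>Li-Yorke pairs\<close>

text \<open>The parent is kept and the offset in it changed by \<open>h k\<close>: its amplitude is
  at most \<open>1\<close>, and \<open>g k\<close> varies by at most
  \<open>(1/2) ^ k\<close>.\<close>

lemma rigid_top:
  assumes "z \<in> Y"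
  shows "\<bar>z (k, j + h k, i) - z (k, j, i)\<bar> \<le> (1/2) ^ k"
proof -
  have *: "z (Suc k, s, i) * g k d i \<le> z (Suc k, s, i) * g k d' i + (1/2) ^ k"
    if "\<bar>g k d i - g k d' i\<bar> \<le> (1/2) ^ k" for s d d'
  proof -
    have "z (Suc k, s, i) * (g k d i - g k d' i) \<le> 1 * \<bar>g k d i - g k d' i\<bar>"
      using Y_nonneg[OF assms, of "Suc k" s i] Y_le_1[OF assms, of "Suc k" s i]
      by (meson abs_ge_self abs_ge_zero mult_left_mono mult_right_mono order_trans)
    then show ?thesis using that by (simp add: right_diff_distrib)
  qed
  obtain d where d: "z (k, j + h k, i) = z (Suc k, j + h k - d, i) * g k d i" using Y_eq[OF assms] by blast
  have "z (Suc k, j + h k - d, i) * g k (d - h k) i \<le> z (k, j, i)"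
    using Y_ge[OF assms, of k j "d - h k" i] by (simp only: diff_diff_eq2)
  then have 1: "z (k, j + h k, i) \<le> z (k, j, i) + (1/2) ^ k"
    using d *[of d "d - h k" "j + h k - d"] g_slow[of k "d - h k" i] by simp
  obtain d where d: "z (k, j, i) = z (Suc k, j - d, i) * g k d i" using Y_eq[OF assms] by blast
  have "z (Suc k, j + h k - (d + h k), i) * g k (d + h k) i \<le> z (k, j + h k, i)" by (rule Y_ge[OF assms])
  then have 2: "z (k, j, i) \<le> z (k, j + h k, i) + (1/2) ^ k"
    using d *[of d "d + h k" "j - d"] g_slow[of k d i] by (simp add: abs_minus_commute)
  from 1 2 show ?thesis by (simp add: abs_le_iff)
qed

text \<open>A translate of a point is again a point of \<open>Y\<close>, so
  \<open>refine_lipschitz\<close> carries the bound from level \<open>k\<close> down to level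
  \<open>l\<close>.\<close>

lemma rigid:
  assumes "z \<in> Y" "l \<le> k"
  shows "\<bar>z (l, j + h k, i) - z (l, j, i)\<bar> \<le> (1/2) ^ k"
  using assms(2)
proof (induction l arbitrary: j rule: inc_induct)
  case base
  then show ?case by (rule rigid_top[OF assms(1)])
next
  case (step l)
  have "\<bar>(\<lambda>(k', j, i). z (k', j + h k, i)) (l, j, i) - z (l, j, i)\<bar> \<le> (1/2) ^ k"
  proof (rule refine_lipschitz[OF Y_translate[OF assms(1)] assms(1)])
    fix d
    show "\<bar>(case (Suc l, j - d, i) of (k', j, i) \<Rightarrow> z (k', j + h k, i)) - z (Suc l, j - d, i)\<bar> \<le> (1/2) ^ k"
      using step.IH[of "j - d"] by simp
  qed simp
  then show ?case by simp
qed

lemma not_asymptotic: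
  assumes "z \<in> Y" "w \<in> Y" "z \<noteq> w"
  shows "\<exists>e>0. \<forall>N. \<exists>m\<ge>N. e \<le> dist ((shift ^^ m) z) ((shift ^^ m) w)"
proof -
  obtain l j i where lji: "z (l, j, i) \<noteq> w (l, j, i)" using assms(3) by (metis ext prod_cases3)
  define a where "a = \<bar>z (l, j, i) - w (l, j, i)\<bar>"
  have "a > 0" using lji by (simp add: a_def)
  then obtain e where e: "e > 0" "\<And>z w :: config. dist z w < e \<Longrightarrow> \<bar>z (l, j, i) - w (l, j, i)\<bar> < a / 2"
    using dist_config_coordinate[of "a / 2" "(l, j, i)"] by auto
  obtain q :: nat where q: "(1/2) ^ q < a / 4" using real_arch_pow_inv[of "a / 4" "1/2"] \<open>a > 0\<close> by auto
  have "\<exists>m\<ge>N. e \<le> dist ((shift ^^ m) z) ((shift ^^ m) w)" for N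
  proof -
    \<comment> \<open>\<open>N\<close> makes the time \<open>h k\<close> late, \<open>l\<close>
      gives rigidity at the coordinate that tells the points apart, and \<open>q\<close> keeps the
      two errors \<open>(1/2) ^ k\<close> below a quarter of the gap \<open>a\<close> each, so more
      than half of it survives.\<close>
    define k where "k = max N (max l q)"
    have k: "N \<le> k" "l \<le> k" "q \<le> k" by (auto simp: k_def)
    define m where "m = nat (h k)"
    have m: "int m = h k" using h_pos[of k] by (simp add: m_def)
    have "N \<le> m" using h_ge[of k] k m by linarith
    have "((1/2) :: real) ^ k \<le> (1/2) ^ q" using k by (intro power_decreasing) auto
    with q have "(1/2) ^ k < a / 4" by linarith
    moreover have "\<not> \<bar>x' - y'\<bar> < \<bar>x - y\<bar> / 2"
      if "\<bar>x' - x\<bar> \<le> p" "\<bar>y' - y\<bar> \<le> p" "p < \<bar>x - y\<bar> / 4" for x x' y y' p :: real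
      using that by (auto simp: abs_real_def split: if_splits)
    ultimately
    have "\<not> \<bar>(shift ^^ m) z (l, j, i) - (shift ^^ m) w (l, j, i)\<bar> < a / 2"
      unfolding shift_funpow m a_def using rigid[OF assms(1) k(2), of j i] rigid[OF assms(2) k(2), of j i]
      by blast
    with e(2)[of "(shift ^^ m) z" "(shift ^^ m) w"] have "e \<le> dist ((shift ^^ m) z) ((shift ^^ m) w)"
      by force
    with \<open>N \<le> m\<close> show ?thesis by blast
  qed
  with e(1) show ?thesis by blast
qed

definition covered :: "nat \<Rightarrow> config \<Rightarrow> int \<Rightarrow> bool" where
  "covered k z t \<longleftrightarrow> (\<exists>s i. - h k < s \<and> s \<le> 0 \<and> z (k, t + s, i) \<noteq> 0)"

text \<open>Times covered through one parent span less than \<open>W k\<close>, and parents are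
  \<open>8 * W k\<close> apart, so such a delay leaves one active part without reaching the
  next.\<close>

lemma covered_gap:
  assumes "z \<in> Y" "covered k z t" "W k \<le> q" "q \<le> 2 * W k"
  shows "\<not> covered k z (t + q)"
proof
  have *: "\<exists>s i. z (Suc k, s, i) \<noteq> 0 \<and> s + W k \<le> t \<and> t < s + 2 * W k" if "covered k z t" for t
  proof -
    from that obtain s i where s: "- h k < s" "s \<le> 0" "z (k, t + s, i) \<noteq> 0" unfolding covered_def by blast
    from Y_parent[OF assms(1) s(3)] obtain d where
      "z (Suc k, t + s - d, i) \<noteq> 0" "W k \<le> d" "d \<le> 2 * W k - h k" by blast
    with s show ?thesis by (intro exI[of _ "t + s - d"] exI[of _ i]) auto
  qed
  assume "covered k z (t + q)"
  from *[OF this] *[OF assms(2)] obtain s i s' i' where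
    s: "z (Suc k, s, i) \<noteq> 0" "s + W k \<le> t" "t < s + 2 * W k" and
    s': "z (Suc k, s', i') \<noteq> 0" "s' + W k \<le> t + q" "t + q < s' + 2 * W k" by blast
  have "s < s'" "\<bar>s - s'\<bar> < 8 * W k" using s s' assms(3,4) W_pos[of k] by auto
  with Y_separated[OF assms(1) s(1) s'(1)] show False by (simp add: h_Suc)
qed

text \<open>Each point is covered at most once among \<open>t0\<close>, \<open>t0 + W k\<close>,
  \<open>t0 + 2 * W k\<close>, so two points cannot use up all three times.\<close>

lemma common_uncovered:
  assumes "z \<in> Y" "w \<in> Y"
  shows "\<exists>t\<ge>t0. \<not> covered k z t \<and> \<not> covered k w t"
proof (rule ccontr)
  assume "\<not> ?thesis"
  then have c: "covered k z t \<or> covered k w t" if "t \<ge> t0" for t using that by blast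
  have *: False if "z \<in> Y" "w \<in> Y" "covered k z t0" "\<And>t. t \<ge> t0 \<Longrightarrow> covered k z t \<or> covered k w t" for z w
  proof -
    note W = W_pos[of k]
    have "\<not> covered k z (t0 + W k)" "\<not> covered k z (t0 + 2 * W k)"
      using covered_gap[OF that(1,3)] W by simp_all
    then have "covered k w (t0 + W k)" "covered k w (t0 + 2 * W k)"
      using that(4)[of "t0 + W k"] that(4)[of "t0 + 2 * W k"] W by simp_all
    with covered_gap[OF that(2), of k "t0 + W k" "W k"] W show False by (simp add: algebra_simps)
  qed
  from c[of t0] show False
  proof
    assume "covered k z t0"
    then show False by (rule *[OF assms]) (rule c)
  next
    assume "covered k w t0"
    then show False by (rule *[OF assms(2,1)]) (use c in blast)
  qed simp
qed

lemma proximal: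
  assumes "z \<in> Y" "w \<in> Y" "e > 0"
  shows "\<exists>m\<ge>N. dist ((shift ^^ m) z) ((shift ^^ m) w) < e"
proof -
  have "e / 3 > 0" using assms(3) by simp
  from dist_lt_if_close[OF this] obtain K where K: "\<forall>z\<in>Y. \<forall>w\<in>Y.
     (\<forall>s i. - h K < s \<and> s \<le> 0 \<and> i < n \<longrightarrow> \<bar>z (K, s, i) - w (K, s, i)\<bar> \<le> e / 3) \<longrightarrow> dist z w < 3 * (e / 3)"
    by (metis order_refl)
  obtain t where t: "t \<ge> int N" "\<not> covered K z t" "\<not> covered K w t"
    using common_uncovered[OF assms(1,2)] by blast
  define m where "m = nat t"
  have m: "int m = t" "m \<ge> N" using t(1) by (auto simp: m_def)
  have "dist ((shift ^^ m) z) ((shift ^^ m) w) < 3 * (e / 3)"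
    using t(2,3) assms(3)
    by (intro K[rule_format] shift_funpow_Y assms(1,2)) (auto simp: m covered_def add.commute)
  with m(2) show ?thesis by auto
qed

subsection \<open>Points with prescribed amplitudes\<close>

definition unit_cube :: "(nat \<Rightarrow> real) set" where
  "unit_cube = {a. \<forall>i. 0 \<le> a i \<and> a i \<le> 1 \<and> (n \<le> i \<longrightarrow> a i = 0)}"

definition full :: "nat \<Rightarrow> int" where
  "full k = (SOME d. W k \<le> d \<and> d \<le> 2 * W k \<and> (\<forall>i<n. g k d i = 1))"

lemma full: "W k \<le> full k" "full k \<le> 2 * W k" "i < n \<Longrightarrow> g k (full k) i = 1"
  unfolding full_def using someI_ex[OF g_full[of k]] by auto

text \<open>Nesting every block at offset \<open>full k\<close> of its parent, where the factor is
  \<open>1\<close>, keeps the amplitude the same at all levels. These are the resulting starts when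
  the level \<open>0\<close> block sits at the origin.\<close>

primrec pos :: "nat \<Rightarrow> int" where
  "pos 0 = 0"
| "pos (Suc k) = pos k - full k"

lemma pos_range: "- h k < pos k \<and> pos k \<le> 0"
proof (induction k)
  case (Suc k)
  then show ?case using full[of k] W_ge[of k] W_pos[of k] h_pos[of k] by (simp add: h_Suc)
qed (use h_pos in simp)

text \<open>The upper bound excludes stray blocks when \<open>a\<close> is zero, where the value at
  the anchored position triggers no separation.\<close>

definition anchored_at :: "(nat \<Rightarrow> real) \<Rightarrow> nat \<Rightarrow> config \<Rightarrow> bool" where
  "anchored_at a k z \<longleftrightarrow> (\<forall>j i. z (k, j, i) \<le> a i) \<and> (\<forall>i. z (k, pos k, i) = a i)"

lemma closed_anchored_at: "closed {z. anchored_at a k z}"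
  unfolding anchored_at_def
  by (intro closed_Collect_all closed_Collect_conj closed_Collect_le closed_Collect_eq continuous_intros)

text \<open>Taking maxima over parents forces level \<open>k\<close>. Separation is inherited:
  starts closer than \<open>h k\<close> have parents closer than \<open>h (Suc k)\<close>, hence the
  same parent, and inside it \<open>g k\<close> keeps them apart.\<close>

lemma refine_step:
  assumes a: "a \<in> unit_cube" and w: "bounded_at (Suc k) w" "separated_at (Suc k) w" "anchored_at a (Suc k) w"
  shows "\<exists>v. (\<forall>k' j i. k' \<noteq> k \<longrightarrow> v (k', j, i) = w (k', j, i)) \<and>
    bounded_at k v \<and> separated_at k v \<and> anchored_at a k v \<and> refined_at k v"
proof -
  define P where "P j i = (\<lambda>d. w (Suc k, j - d, i) * g k d i) ` {0..2 * W k}" for j i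
  define v where "v = (\<lambda>(k', j, i). if k' = k then Max (P j i) else w (k', j, i))"
  have v_k: "v (k, j, i) = Max (P j i)" and v_Suc: "v (Suc k, j, i) = w (Suc k, j, i)" for j i
    by (simp_all add: v_def)
  have P: "finite (P j i)" "P j i \<noteq> {}" for j i
    using W_pos[of k] by (auto simp: P_def)
  have w0: "0 \<le> w (Suc k, j, i)" for j i
    using w(1) by (simp add: bounded_at_def)
  have wa: "w (Suc k, j, i) \<le> a i" and wpos: "w (Suc k, pos (Suc k), i) = a i" for j i
    using w(3) unfolding anchored_at_def by blast+
  have ex: "\<exists>d\<in>{0..2 * W k}. v (k, j, i) = w (Suc k, j - d, i) * g k d i" for j i
    using Max_in[OF P, of j i] unfolding v_k by (auto simp: P_def)
  have v0: "0 \<le> v (k, j, i)" for j i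
    using ex[of j i] w0 g_nonneg by (metis mult_nonneg_nonneg)
  have va: "v (k, j, i) \<le> a i" for j i
  proof -
    obtain d where d: "v (k, j, i) = w (Suc k, j - d, i) * g k d i" using ex by blast
    have "\<dots> \<le> w (Suc k, j - d, i) * 1" using w0 g_le_1 by (intro mult_left_mono)
    with d wa[of "j - d" i] show ?thesis by simp
  qed
  have ge: "w (Suc k, j - d, i) * g k d i \<le> v (k, j, i)" for j i d
  proof (cases "g k d i = 0")
    case False
    then have "W k \<le> d" "d \<le> 2 * W k - h k" using g_support by blast+
    then have "d \<in> {0..2 * W k}" using W_pos[of k] h_pos[of k] by auto
    then show ?thesis unfolding v_k using P(1) by (intro Max_ge) (auto simp: P_def)
  qed (use v0 in simp)
  have a1: "a i \<le> 1" "n \<le> i \<Longrightarrow> a i = 0" for i using a by (auto simp: unit_cube_def)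
  have "bounded_at k v"
    unfolding bounded_at_def using v0 va a1 by (metis antisym order_trans)
  moreover have "anchored_at a k v"
  proof -
    have "v (k, pos k, i) = a i" for i
    proof (cases "i < n")
      case True
      then have "a i \<le> v (k, pos k, i)"
        using ge[of "pos k" "full k" i] wpos[of i] full(3)[of i k] by simp
      with va[of "pos k" i] show ?thesis by simp
    next
      case False
      then show ?thesis using a1(2)[of i] v0[of "pos k" i] va[of "pos k" i] by simp
    qed
    with va show ?thesis by (simp add: anchored_at_def)
  qed
  moreover have "separated_at k v"
    unfolding separated_at_def
  proof (intro allI impI, elim conjE)
    fix j i j' i' assume nz: "v (k, j, i) \<noteq> 0" "v (k, j', i') \<noteq> 0" and neq: "j \<noteq> j'"
    obtain d d' where d: "v (k, j, i) = w (Suc k, j - d, i) * g k d i"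
      "v (k, j', i') = w (Suc k, j' - d', i') * g k d' i'" using ex by meson
    with nz have nz': "w (Suc k, j - d, i) \<noteq> 0" "g k d i \<noteq> 0" "w (Suc k, j' - d', i') \<noteq> 0" "g k d' i' \<noteq> 0"
      by auto
    show "h k \<le> \<bar>j - j'\<bar>"
    proof (rule ccontr)
      assume c: "\<not> h k \<le> \<bar>j - j'\<bar>"
      have "\<bar>(j - d) - (j' - d')\<bar> < h (Suc k)"
        using g_support[OF nz'(2)] g_support[OF nz'(4)] c W_ge[of k] h_pos[of k] by (auto simp: h_Suc)
      moreover have "j - d \<noteq> j' - d' \<longrightarrow> h (Suc k) \<le> \<bar>(j - d) - (j' - d')\<bar>"
        using w(2)[unfolded separated_at_def] nz'(1,3) by blast
      ultimately have "j - d = j' - d'" by linarith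
      then have "d \<noteq> d'" "\<bar>d - d'\<bar> = \<bar>j - j'\<bar>" using neq by auto
      with g_separated[OF nz'(2,4)] c show False by simp
    qed
  qed
  moreover have "refined_at k v"
    unfolding refined_at_def v_Suc using ge ex by blast
  moreover have "\<forall>k' j i. k' \<noteq> k \<longrightarrow> v (k', j, i) = w (k', j, i)" by (simp add: v_def)
  ultimately show ?thesis by blast
qed

definition valid_upto :: "(nat \<Rightarrow> real) \<Rightarrow> nat \<Rightarrow> config set" where
  "valid_upto a m = {z. (\<forall>k\<le>m. bounded_at k z \<and> separated_at k z \<and> anchored_at a k z) \<and>
     (\<forall>k<m. refined_at k z)}"

text \<open>A single block of amplitude \<open>a\<close> at level \<open>m\<close> is refined
  downwards; \<open>q\<close> counts the levels already filled, and all others are harmless.\<close>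

lemma valid_upto_nonempty:
  assumes a: "a \<in> unit_cube"
  shows "hilbert_cube \<inter> valid_upto a m \<noteq> {}"
proof -
  have "q \<le> m \<Longrightarrow> \<exists>w. (\<forall>k. bounded_at k w) \<and>
     (\<forall>k. m - q \<le> k \<and> k \<le> m \<longrightarrow> separated_at k w \<and> anchored_at a k w) \<and>
     (\<forall>k. m - q \<le> k \<and> k < m \<longrightarrow> refined_at k w)" for q
  proof (induction q)
    case 0
    have a': "\<And>i. 0 \<le> a i" "\<And>i. a i \<le> 1" "\<And>i. n \<le> i \<Longrightarrow> a i = 0" using a by (auto simp: unit_cube_def)
    define w :: config where "w = (\<lambda>(k, j, i). if k = m \<and> j = pos m then a i else 0)"
    have "\<forall>k. bounded_at k w" using a' by (auto simp: bounded_at_def w_def)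
    moreover have "separated_at m w" by (auto simp: separated_at_def w_def)
    moreover have "anchored_at a m w" using a' by (auto simp: anchored_at_def w_def)
    ultimately show ?case by (intro exI[of _ w]) auto
  next
    case (Suc q)
    define k where "k = m - Suc q"
    have k: "Suc k = m - q" "k < m" using Suc.prems by (auto simp: k_def)
    from Suc obtain w where w: "\<forall>k. bounded_at k w"
      "\<forall>k. m - q \<le> k \<and> k \<le> m \<longrightarrow> separated_at k w \<and> anchored_at a k w"
      "\<forall>k. m - q \<le> k \<and> k < m \<longrightarrow> refined_at k w" by auto
    have sk: "separated_at (Suc k) w" "anchored_at a (Suc k) w" using w(2) k by auto
    obtain v where v: "\<forall>k' j i. k' \<noteq> k \<longrightarrow> v (k', j, i) = w (k', j, i)"
      "bounded_at k v" "separated_at k v" "anchored_at a k v" "refined_at k v"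
      using refine_step[OF a w(1)[rule_format] sk] by blast
    have eq: "bounded_at k' v = bounded_at k' w" "separated_at k' v = separated_at k' w"
       "anchored_at a k' v = anchored_at a k' w" if "k' \<noteq> k" for k'
      using that v(1) by (simp_all add: bounded_at_def separated_at_def anchored_at_def)
    have eq': "refined_at k' v = refined_at k' w" if "k' > k" for k'
      using that v(1) by (simp add: refined_at_def)
    have "bounded_at k' v" for k' using eq[of k'] w(1) v(2) by (cases "k' = k") auto
    moreover have "separated_at k' v \<and> anchored_at a k' v" if "k \<le> k'" "k' \<le> m" for k'
      using eq[of k'] w(2) v(3,4) that k by (cases "k' = k") auto
    moreover have "refined_at k' v" if "k \<le> k'" "k' < m" for k'
      using eq'[of k'] w(3) v(5) that k by (cases "k' = k") auto
    ultimately show ?case unfolding k_def by blast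
  qed
  from this[of m] obtain w where "\<forall>k. bounded_at k w"
    "\<forall>k\<le>m. separated_at k w \<and> anchored_at a k w" "\<forall>k<m. refined_at k w" by auto
  then have "w \<in> hilbert_cube \<inter> valid_upto a m" using bounded_in_hilbert_cube by (auto simp: valid_upto_def)
  then show ?thesis by blast
qed

lemma closed_valid_upto: "closed (valid_upto a m)"
proof -
  have "closed {z. k \<le> m \<longrightarrow> bounded_at k z \<and> separated_at k z \<and> anchored_at a k z}" for k
    by (cases "k \<le> m") (simp_all add: closed_Collect_conj closed_bounded_at closed_separated_at closed_anchored_at)
  moreover have "closed {z. k < m \<longrightarrow> refined_at k z}" for k
    by (cases "k < m") (simp_all add: closed_refined_at)
  ultimately show ?thesis
    unfolding valid_upto_def by (intro closed_Collect_conj closed_Collect_all)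
qed

text \<open>Each level is built from the one above and there is no top level, so the constraints at
  all levels are met together by compactness.\<close>

lemma anchored_point_exists:
  assumes "a \<in> unit_cube"
  shows "\<exists>z\<in>Y. \<forall>k. anchored_at a k z"
proof -
  have "hilbert_cube \<inter> (\<Inter>m\<in>UNIV. valid_upto a m) \<noteq> {}"
  proof (rule compact_imp_fip_image[OF compact_hilbert_cube])
    fix I :: "nat set" assume "finite I"
    then obtain m where m: "\<forall>k\<in>I. k \<le> m" using finite_nat_set_iff_bounded_le by blast
    obtain z where "z \<in> hilbert_cube" "z \<in> valid_upto a m" using valid_upto_nonempty[OF assms, of m] by blast
    then have "z \<in> hilbert_cube \<inter> (\<Inter>k\<in>I. valid_upto a k)" using m by (force simp: valid_upto_def)
    then show "hilbert_cube \<inter> (\<Inter>k\<in>I. valid_upto a k) \<noteq> {}" by blast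
  qed (rule closed_valid_upto)
  then obtain z where z: "\<And>m. z \<in> valid_upto a m" by blast
  have "bounded_at k z \<and> separated_at k z \<and> refined_at k z" for k
    using z[of "Suc k"] by (simp add: valid_upto_def)
  then have "z \<in> Y" by (simp add: Y_def)
  moreover have "anchored_at a k z" for k using z[of k] by (simp add: valid_upto_def)
  ultimately show ?thesis by blast
qed

definition anchored_point :: "(nat \<Rightarrow> real) \<Rightarrow> config" where
  "anchored_point a = (SOME z. z \<in> Y \<and> (\<forall>k. anchored_at a k z))"

lemma anchored_point:
  assumes "a \<in> unit_cube"
  shows "anchored_point a \<in> Y" "anchored_point a (k, pos k, i) = a i" "anchored_point a (k, j, i) \<le> a i"
proof -
  have "\<exists>z. z \<in> Y \<and> (\<forall>k. anchored_at a k z)" using anchored_point_exists[OF assms] by blast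
  from someI_ex[OF this] have "anchored_point a \<in> Y \<and> (\<forall>k. anchored_at a k (anchored_point a))"
    unfolding anchored_point_def .
  then show "anchored_point a \<in> Y" "anchored_point a (k, pos k, i) = a i" "anchored_point a (k, j, i) \<le> a i"
    unfolding anchored_at_def by blast+
qed

lemma anchored_point_off:
  assumes "a \<in> unit_cube" "- h k < s" "s \<le> 0" "s \<noteq> pos k"
  shows "anchored_point a (k, s, i) = 0"
proof (rule ccontr)
  note p = anchored_point[OF assms(1)]
  assume nz: "anchored_point a (k, s, i) \<noteq> 0"
  then have "a i \<noteq> 0" using p(3)[of k s i] Y_nonneg[OF p(1), of k s i] by auto
  then have "anchored_point a (k, pos k, i) \<noteq> 0" using p(2) by simp
  from Y_separated[OF p(1) nz this assms(4)] assms(2,3) pos_range[of k] show False by auto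
qed

text \<open>\<open>anchored_point\<close> is an arbitrary choice, yet every window around the origin
  shows the anchored block only, and this determines all lower levels nearby. Since amplitudes are
  read off at \<open>pos k\<close>, this embeds the cube in \<open>Y\<close>.\<close>

lemma anchored_point_lipschitz:
  assumes "a \<in> unit_cube" "b \<in> unit_cube" "0 \<le> e" "\<And>i. \<bar>a i - b i\<bar> \<le> e"
  shows "\<bar>anchored_point a (l, j, i) - anchored_point b (l, j, i)\<bar> \<le> e"
proof -
  define K where "K = max l (nat \<bar>j\<bar>)"
  show ?thesis
  proof (rule window_lipschitz[OF anchored_point(1)[OF assms(1)] anchored_point(1)[OF assms(2)] assms(3)])
    show "l \<le> K" by (simp add: K_def)
    show "\<bar>j\<bar> \<le> 2 * h K" using h_ge[of K] unfolding K_def by linarith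
    fix s i assume "- h (Suc K) < s" "s \<le> 0"
    then show "\<bar>anchored_point a (Suc K, s, i) - anchored_point b (Suc K, s, i)\<bar> \<le> e"
      using assms anchored_point(2)[OF assms(1), of "Suc K" i] anchored_point(2)[OF assms(2), of "Suc K" i]
        anchored_point_off[OF assms(1), of "Suc K" s i] anchored_point_off[OF assms(2), of "Suc K" s i]
      by (cases "s = pos (Suc K)") (simp_all del: pos.simps)
  qed
qed

subsection \<open>Weak mixing\<close>

definition translate :: "int \<Rightarrow> config \<Rightarrow> config" where
  "translate t z = (\<lambda>(k, j, i). z (k, j + t, i))"

lemma translate_apply [simp]: "translate t z (k, j, i) = z (k, j + t, i)"
  by (simp add: translate_def)

lemma translate_in_Y: "z \<in> Y \<Longrightarrow> translate t z \<in> Y"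
  unfolding translate_def by (rule Y_translate)

lemma shift_funpow_translate: "(shift ^^ m) (translate t z) = translate (t + int m) z"
proof
  fix x show "(shift ^^ m) (translate t z) x = translate (t + int m) z x"
    by (cases x) (simp add: algebra_simps)
qed

text \<open>Below a parent of amplitude \<open>1\<close> at the origin, level \<open>K\<close>
  displays the pattern \<open>g K\<close> itself; other parents are too far away to
  interfere.\<close>

lemma full_point_exists: "\<exists>z\<in>Y. \<forall>d i. \<bar>d\<bar> \<le> 3 * W K \<longrightarrow> z (K, d, i) = g K d i"
proof -
  define a where "a i = (if i < n then 1 else 0 :: real)" for i
  have a: "a \<in> unit_cube" by (auto simp: unit_cube_def a_def)
  define z where "z = translate (pos (Suc K)) (anchored_point a)"
  have z: "z \<in> Y" unfolding z_def by (intro translate_in_Y anchored_point(1) a)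
  have z1: "z (Suc K, 0, i) = 1" if "i < n" for i
    using anchored_point(2)[OF a, of "Suc K" i] that by (simp add: z_def a_def)
  have "z (K, d, i) = g K d i" if d: "\<bar>d\<bar> \<le> 3 * W K" for d i
  proof (cases "i < n")
    case True
    have "g K d i \<le> z (K, d, i)" using Y_ge[OF z, of K d d i] z1[OF True] by simp
    moreover have "z (K, d, i) \<le> g K d i"
    proof (cases "z (K, d, i) = 0")
      case True
      then show ?thesis using g_nonneg by simp
    next
      case False
      then obtain c where c: "z (K, d, i) = z (Suc K, d - c, i) * g K c i" "z (Suc K, d - c, i) \<noteq> 0"
        "W K \<le> c" "c \<le> 2 * W K - h K" using Y_parent[OF z] by blast
      have "d - c = 0"
      proof (rule ccontr)
        assume "d - c \<noteq> 0"
        from Y_separated[OF z c(2) _ this, of i] z1[OF True] d c(3,4) W_pos[of K] h_pos[of K]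
        show False by (auto simp: h_Suc)
      qed
      with c(1) z1[OF True] show ?thesis by simp
    qed
    ultimately show ?thesis by simp
  next
    case False
    then show ?thesis using Y_out[OF z] g_support by (metis not_le)
  qed
  with z show ?thesis by blast
qed

text \<open>The wedge structure of a window. In an empty window any position serves;
  \<open>0\<close> is taken.\<close>

lemma unique_start:
  assumes "u \<in> Y"
  shows "\<exists>s. - h K < s \<and> s \<le> 0 \<and> (\<forall>s' i. - h K < s' \<and> s' \<le> 0 \<and> s' \<noteq> s \<longrightarrow> u (K, s', i) = 0)"
proof (cases "\<exists>s i. - h K < s \<and> s \<le> 0 \<and> u (K, s, i) \<noteq> 0")
  case True
  then obtain s i where s: "- h K < s" "s \<le> 0" "u (K, s, i) \<noteq> 0" by blast
  have "u (K, s', i') = 0" if "- h K < s'" "s' \<le> 0" "s' \<noteq> s" for s' i'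
    using Y_separated[OF assms s(3), of s' i'] that s by force
  with s show ?thesis by blast
next
  case False
  then show ?thesis using h_pos[of K] by (intro exI[of _ 0]) auto
qed

text \<open>Both points are translates of one point that displays \<open>g K\<close>. Each target is
  a position and an amplitude, imitated at one of the four offsets from
  \<open>g_mixing\<close>.\<close>

lemma weak_mixing_points:
  assumes "u1 \<in> Y" "u2 \<in> Y" "u3 \<in> Y" "u4 \<in> Y" "e > 0"
  shows "\<exists>m>0. \<exists>x\<in>Y. \<exists>y\<in>Y. dist x u1 < e \<and> dist ((shift ^^ m) x) u2 < e \<and>
     dist y u3 < e \<and> dist ((shift ^^ m) y) u4 < e"
proof -
  have "e / 3 > 0" using assms(5) by simp
  from dist_lt_if_close[OF this] obtain K0 where K0: "\<forall>K\<ge>K0. \<forall>z\<in>Y. \<forall>w\<in>Y.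
     (\<forall>s i. - h K < s \<and> s \<le> 0 \<and> i < n \<longrightarrow> \<bar>z (K, s, i) - w (K, s, i)\<bar> \<le> e / 3) \<longrightarrow> dist z w < 3 * (e / 3)"
    by blast
  obtain q :: nat where q: "(1/2) ^ q < e / 3" using real_arch_pow_inv[OF \<open>e / 3 > 0\<close>, of "1/2"] by auto
  define K where "K = max K0 q"
  have "((1/2) :: real) ^ K \<le> (1/2) ^ q" by (intro power_decreasing) (auto simp: K_def)
  with q have eK: "(1/2) ^ K \<le> e / 3" by linarith
  obtain z where z: "z \<in> Y" "\<And>d i. \<bar>d\<bar> \<le> 3 * W K \<Longrightarrow> z (K, d, i) = g K d i"
    using full_point_exists by blast
  have near: "\<exists>s. - h K < s \<and> s \<le> 0 \<and> (\<forall>d. approximates n (h K) ((1/2) ^ K) (W K) (g K) d (\<lambda>i. u (K, s, i)) \<longrightarrow>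
      dist (translate (d - s) z) u < e)" if u: "u \<in> Y" for u
  proof -
    obtain s where s: "- h K < s" "s \<le> 0" "\<And>s' i. - h K < s' \<Longrightarrow> s' \<le> 0 \<Longrightarrow> s' \<noteq> s \<Longrightarrow> u (K, s', i) = 0"
      using unique_start[OF u, of K] by blast
    have "dist (translate (d - s) z) u < 3 * (e / 3)"
      if ap: "approximates n (h K) ((1/2) ^ K) (W K) (g K) d (\<lambda>i. u (K, s, i))" for d
    proof (rule K0[rule_format])
      show "K0 \<le> K" by (simp add: K_def)
      show "translate (d - s) z \<in> Y" "u \<in> Y" using z u by (auto intro: translate_in_Y)
      fix s' i assume s': "- h K < s' \<and> s' \<le> 0 \<and> i < n"
      have d: "W K \<le> d" "d \<le> 2 * W K" "i < n \<Longrightarrow> \<bar>g K d i - u (K, s, i)\<bar> \<le> (1/2) ^ K"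
        "\<And>d'. d' \<noteq> d \<Longrightarrow> \<bar>d' - d\<bar> < h K \<Longrightarrow> g K d' i = 0"
        using ap by (auto simp: approximates_def)
      have "translate (d - s) z (K, s', i) = g K (d + (s' - s)) i"
        using z(2)[of "d + (s' - s)" i] d(1,2) s s' W_ge[of K] h_pos[of K] by (simp add: algebra_simps)
      moreover have "\<bar>g K (d + (s' - s)) i - u (K, s', i)\<bar> \<le> e / 3"
      proof (cases "s' = s")
        case True
        then show ?thesis using d(3) s' eK by simp
      next
        case False
        then have "u (K, s', i) = 0" using s(3) s' by blast
        moreover have "g K (d + (s' - s)) i = 0" using False s s' by (intro d(4)) auto
        ultimately show ?thesis using \<open>e / 3 > 0\<close> by simp
      qed
      ultimately show "\<bar>translate (d - s) z (K, s', i) - u (K, s', i)\<bar> \<le> e / 3" by simp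
    qed
    with s show ?thesis by (intro exI[of _ s]) simp
  qed
  obtain s1 s2 s3 s4 where
    s1: "- h K < s1" "s1 \<le> 0" "\<And>d. approximates n (h K) ((1/2) ^ K) (W K) (g K) d (\<lambda>i. u1 (K, s1, i)) \<Longrightarrow>
      dist (translate (d - s1) z) u1 < e" and
    s2: "- h K < s2" "s2 \<le> 0" "\<And>d. approximates n (h K) ((1/2) ^ K) (W K) (g K) d (\<lambda>i. u2 (K, s2, i)) \<Longrightarrow>
      dist (translate (d - s2) z) u2 < e" and
    s3: "- h K < s3" "s3 \<le> 0" "\<And>d. approximates n (h K) ((1/2) ^ K) (W K) (g K) d (\<lambda>i. u3 (K, s3, i)) \<Longrightarrow>
      dist (translate (d - s3) z) u3 < e" and
    s4: "- h K < s4" "s4 \<le> 0" "\<And>d. approximates n (h K) ((1/2) ^ K) (W K) (g K) d (\<lambda>i. u4 (K, s4, i)) \<Longrightarrow>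
      dist (translate (d - s4) z) u4 < e"
    using near[OF assms(1)] near[OF assms(2)] near[OF assms(3)] near[OF assms(4)] by metis
  have cube: "\<forall>i<n. 0 \<le> u (K, s, i) \<and> u (K, s, i) \<le> 1" if "u \<in> Y" for u s
    using Y_nonneg[OF that] Y_le_1[OF that] by blast
  \<comment> \<open>With this shift in \<open>g_mixing\<close>, \<open>(d2 - s2) - (d1 - s1)\<close>
    equals \<open>(d4 - s4) - (d3 - s3)\<close>, so one time serves both points. It is positive
    since \<open>d1 + h K < d2\<close> while positions differ by less than
    \<open>h K\<close>.\<close>
  have "\<bar>(s4 - s3) - (s2 - s1)\<bar> \<le> 2 * h K" using s1 s2 s3 s4 by linarith
  from g_mixing[OF this cube[OF assms(1)] cube[OF assms(2)] cube[OF assms(3)] cube[OF assms(4)], of s1 s2 s3 s4]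
  obtain d1 d2 d3 d4 where d: "d1 + h K < d2" "d4 - d3 = d2 - d1 + ((s4 - s3) - (s2 - s1))"
    and ap: "approximates n (h K) ((1/2) ^ K) (W K) (g K) d1 (\<lambda>i. u1 (K, s1, i))"
     "approximates n (h K) ((1/2) ^ K) (W K) (g K) d2 (\<lambda>i. u2 (K, s2, i))"
     "approximates n (h K) ((1/2) ^ K) (W K) (g K) d3 (\<lambda>i. u3 (K, s3, i))"
     "approximates n (h K) ((1/2) ^ K) (W K) (g K) d4 (\<lambda>i. u4 (K, s4, i))"
    by blast
  define m where "m = nat ((d2 - s2) - (d1 - s1))"
  have m: "int m = (d2 - s2) - (d1 - s1)" "m > 0" using d(1) s1 s2 by (auto simp: m_def)
  have "d1 - s1 + int m = d2 - s2" "d3 - s3 + int m = d4 - s4" using m d(2) by auto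
  then show ?thesis
    using m(2) s1(3)[OF ap(1)] s2(3)[OF ap(2)] s3(3)[OF ap(3)] s4(3)[OF ap(4)] translate_in_Y[OF z(1)]
    by (intro exI[of _ m] conjI bexI[of _ "translate (d1 - s1) z"] bexI[of _ "translate (d3 - s3) z"])
      (simp_all add: shift_funpow_translate)
qed

end

section \<open>Covering dimension\<close>

lemma open_Collect_finite_ball:
  assumes "finite A" "\<And>a. a \<in> A \<Longrightarrow> open {x. P a x}"
  shows "open {x. \<forall>a\<in>A. P a x}"
  unfolding Collect_ball_eq using assms by (intro open_INT) auto

lemma lebesgue_number_openin:
  fixes S :: "'a :: metric_space set"
  assumes "compact S" "\<And>U. U \<in> \<U> \<Longrightarrow> openin (top_of_set S) U" "\<Union>\<U> = S"
  shows "\<exists>e>0. \<forall>x\<in>S. \<exists>U\<in>\<U>. ball x e \<inter> S \<subseteq> U"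
proof -
  define \<C> where "\<C> = {T. open T \<and> S \<inter> T \<in> \<U>}"
  have cov: "S \<subseteq> \<Union>\<C>"
  proof
    fix x assume "x \<in> S"
    then obtain U where U: "U \<in> \<U>" "x \<in> U" using assms(3) by blast
    then obtain T where "open T" "U = S \<inter> T" using assms(2) by (meson openin_open)
    with U have "T \<in> \<C>" "x \<in> T" by (auto simp: \<C>_def)
    then show "x \<in> \<Union>\<C>" by blast
  qed
  have "\<exists>e>0. \<forall>x\<in>S. \<exists>T\<in>\<C>. ball x e \<subseteq> T"
  proof (rule Heine_Borel_lemma[OF assms(1) cov])
    show "open T" if "T \<in> \<C>" for T using that by (simp add: \<C>_def)
    show ?thesis if "0 < e" "\<And>x. x \<in> S \<Longrightarrow> \<exists>T\<in>\<C>. ball x e \<subseteq> T" for e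
      using that by blast
  qed
  then obtain e where e: "0 < e" "\<And>x. x \<in> S \<Longrightarrow> \<exists>T\<in>\<C>. ball x e \<subseteq> T"
    by blast
  have "\<exists>U\<in>\<U>. ball x e \<inter> S \<subseteq> U" if x: "x \<in> S" for x
  proof -
    obtain T where "T \<in> \<C>" "ball x e \<subseteq> T" using e(2)[OF x] by blast
    then show ?thesis by (intro bexI[of _ "S \<inter> T"]) (auto simp: \<C>_def)
  qed
  with e(1) show ?thesis by blast
qed

text \<open>The open star of the lattice point \<open>v\<close> in the Freudenthal triangulation. The lattice points
  whose stars contain a given point form a chain, so there are at most \<open>n + 1\<close> of them.\<close>

definition star :: "nat \<Rightarrow> (nat \<Rightarrow> nat) \<Rightarrow> (nat \<Rightarrow> real) \<Rightarrow> bool" where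
  "star n v x \<longleftrightarrow> (\<forall>i<n. \<bar>x i - real (v i)\<bar> < 1) \<and>
     (\<forall>i<n. \<forall>j<n. (x i - real (v i)) - (x j - real (v j)) < 1)"

text \<open>If \<open>v\<close> and \<open>w\<close> were incomparable at \<open>i\<close> and
  \<open>j\<close>, adding their two star inequalities would bound by less than \<open>2\<close> a
  sum of two integer gaps, each at least \<open>1\<close>.\<close>

lemma star_chain:
  assumes "star n v x" "star n w x"
  shows "(\<forall>i<n. v i \<le> w i) \<or> (\<forall>i<n. w i \<le> v i)"
proof (rule ccontr)
  assume "\<not> ?thesis"
  then obtain i j where ij: "i < n" "j < n" "v i < w i" "w j < v j" by (auto simp: not_le)
  have "(x i - real (v i)) - (x j - real (v j)) < 1" "(x j - real (w j)) - (x i - real (w i)) < 1"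
    using assms ij(1,2) unfolding star_def by blast+
  moreover have "real (v i) + 1 \<le> real (w i)" "real (w j) + 1 \<le> real (v j)" using ij by auto
  ultimately show False by linarith
qed

text \<open>On a chain the coordinate sum is injective, and it takes at most \<open>n + 1\<close>
  values because each coordinate is one of two consecutive integers.\<close>

lemma card_star_le:
  assumes "I \<subseteq> extensional {..<n}"
  shows "card {v \<in> I. star n v x} \<le> n + 1"
proof -
  define c where "c = (\<Sum>i<n. nat \<lfloor>x i\<rfloor>)"
  have 1: "(\<Sum>i<n. v i) \<in> {c..c + n}" if "star n v x" for v
  proof -
    have "nat \<lfloor>x i\<rfloor> \<le> v i \<and> v i \<le> nat \<lfloor>x i\<rfloor> + 1" if "i < n" for i
    proof -
      have "\<bar>x i - real (v i)\<bar> < 1" using \<open>star n v x\<close> that by (simp add: star_def)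
      then show ?thesis by linarith
    qed
    then have "(\<Sum>i<n. nat \<lfloor>x i\<rfloor>) \<le> (\<Sum>i<n. v i)" "(\<Sum>i<n. v i) \<le> (\<Sum>i<n. nat \<lfloor>x i\<rfloor> + 1)"
      by (intro sum_mono; simp)+
    moreover have "(\<Sum>i<n. nat \<lfloor>x i\<rfloor> + 1) = c + n"
      by (simp only: sum.distrib c_def) simp
    ultimately show ?thesis by (simp add: c_def)
  qed
  have 2: "inj_on (\<lambda>v. \<Sum>i<n. v i) {v \<in> I. star n v x}"
  proof (rule inj_onI)
    fix v w assume v: "v \<in> {v \<in> I. star n v x}" and w: "w \<in> {v \<in> I. star n v x}"
      and eq: "(\<Sum>i<n. v i) = (\<Sum>i<n. w i)"
    have *: "\<forall>i<n. v i = w i" if le: "\<forall>i<n. v i \<le> w i" and eq: "(\<Sum>i<n. v i) = (\<Sum>i<n. w i)" for v w :: "nat \<Rightarrow> nat"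
    proof (intro allI impI)
      fix i assume "i < n"
      then show "v i = w i" using sum_mono_inv[OF eq, of i] le by simp
    qed
    have "star n v x" "star n w x" using v w by simp_all
    then have "\<forall>i<n. v i = w i"
      using star_chain *[OF _ eq] *[OF _ eq[symmetric]] by metis
    then show "v = w" using v w assms by (intro extensionalityI[of v "{..<n}"]) auto
  qed
  have "card {v \<in> I. star n v x} \<le> card {c..c + n}"
    using 1 by (intro card_inj_on_le[OF 2]) auto
  then show ?thesis by simp
qed

text \<open>Rounding down puts all residues in \<open>[0,1)\<close>, which meets both star
  conditions; so the stars cover the nonnegative orthant.\<close>

lemma star_floor:
  assumes "\<forall>i<n. 0 \<le> x i"
  shows "star n (\<lambda>i\<in>{..<n}. nat \<lfloor>x i\<rfloor>) x"
proof -
  have *: "0 \<le> x i - real (nat \<lfloor>x i\<rfloor>) \<and> x i - real (nat \<lfloor>x i\<rfloor>) < 1" if "i < n" for i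
  proof -
    have "0 \<le> x i" using assms that by simp
    then have "real (nat \<lfloor>x i\<rfloor>) = of_int \<lfloor>x i\<rfloor>" by simp
    then show ?thesis using of_int_floor_le[of "x i"] floor_less_iff[of "x i" "\<lfloor>x i\<rfloor> + 1"] by linarith
  qed
  define f where "f i = nat \<lfloor>x i\<rfloor>" for i
  show ?thesis
    unfolding star_def f_def[symmetric]
  proof (intro conjI allI impI)
    fix i assume "i < n"
    then show "\<bar>x i - real ((\<lambda>i\<in>{..<n}. f i) i)\<bar> < 1"
      using *[of i, folded f_def] by simp
    fix j assume "j < n"
    with \<open>i < n\<close> show "(x i - real ((\<lambda>i\<in>{..<n}. f i) i)) - (x j - real ((\<lambda>i\<in>{..<n}. f i) j)) < 1"
      using *[of i, folded f_def] *[of j, folded f_def] by simp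
  qed
qed

context tower
begin

subsection \<open>The dimension is at most \<open>n\<close>\<close>

lemma covering_dim_le_Y: "covering_dim_le (top_of_set Y) n"
  unfolding covering_dim_le_def
proof (intro allI impI, elim conjE)
  fix \<U> :: "config set set"
  assume \<U>: "finite \<U>" "\<forall>U\<in>\<U>. openin (top_of_set Y) U" "\<Union>\<U> = topspace (top_of_set Y)"
  obtain e where e: "e > 0" "\<And>x. x \<in> Y \<Longrightarrow> \<exists>U\<in>\<U>. ball x e \<inter> Y \<subseteq> U"
    using lebesgue_number_openin[OF compact_Y, of \<U>] \<U> by auto
  have "Y \<noteq> {}" using full_point_exists[of 0] by blast
  then have "\<U> \<noteq> {}" using e(2) by blast
  have "e / 3 > 0" using e(1) by simp
  from dist_lt_if_close[OF this] obtain K where K: "\<forall>z\<in>Y. \<forall>w\<in>Y.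
     (\<forall>s i. - h K < s \<and> s \<le> 0 \<and> i < n \<longrightarrow> \<bar>z (K, s, i) - w (K, s, i)\<bar> \<le> e / 3) \<longrightarrow> dist z w < 3 * (e / 3)"
    by (metis order_refl)
  obtain N0 :: nat where "2 / (e / 3) < real N0" using reals_Archimedean2 by blast
  then obtain N :: nat where N: "N > 0" "2 / real N \<le> e / 3"
    using e(1) by (intro that[of "Suc N0"]) (auto simp: field_simps)
  define sc where "sc s z = (\<lambda>i. real N * z (K, s, i))" for s and z :: config
  define Idx where "Idx = (\<Pi>\<^sub>E i\<in>{..<n}. {..N})"
  define org where "org = (\<lambda>i\<in>{..<n}. 0 :: nat)"
  define Pos where "Pos = {- h K<..0}"
  \<comment> \<open>The cubes of all positions share the vertex zero, so its star is one set across
    positions. Every other star forces a nonzero amplitude and so belongs to a single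
    position.\<close>
  define V0 where "V0 = {z \<in> Y. \<forall>s\<in>Pos. star n org (sc s z)}"
  define V where "V = (\<lambda>(s, v). {z \<in> Y. star n v (sc s z)})"
  define \<V> where "\<V> = insert V0 (V ` (Pos \<times> (Idx - {org})))"
  have "finite Idx" unfolding Idx_def by (intro finite_PiE) auto
  have ext: "Idx \<subseteq> extensional {..<n}" by (auto simp: Idx_def PiE_def)
  have oI: "org \<in> Idx" by (auto simp: Idx_def org_def)
  have finP: "finite Pos" by (simp add: Pos_def)
  have star0: "star n org (sc s z) \<longleftrightarrow> (\<forall>i<n. sc s z i < 1)" if "z \<in> Y" for s z
  proof -
    have nn: "0 \<le> sc s z i" for i using Y_nonneg[OF that] by (simp add: sc_def)
    show ?thesis
    proof
      assume lt: "\<forall>i<n. sc s z i < 1"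
      show "star n org (sc s z)"
        unfolding star_def
      proof (intro conjI allI impI)
        fix i assume i: "i < n"
        then show "\<bar>sc s z i - real (org i)\<bar> < 1" using nn[of i] lt by (simp add: org_def)
        fix j assume "j < n"
        with i show "sc s z i - real (org i) - (sc s z j - real (org j)) < 1"
          using nn[of j] lt[rule_format, OF i] by (simp add: org_def)
      qed
    qed (auto simp: star_def org_def)
  qed
  have star_nz: "\<exists>i. z (K, s, i) \<noteq> 0" if "z \<in> Y" "v \<in> Idx" "v \<noteq> org" "star n v (sc s z)" for z s v
  proof (rule ccontr)
    assume "\<not> ?thesis"
    then have "sc s z i = 0" for i by (simp add: sc_def)
    with that(4) have "v i = 0" if "i < n" for i using that by (auto simp: star_def)
    then have "v = org" using that(2) ext by (intro extensionalityI[of v "{..<n}"]) (auto simp: org_def)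
    with that(3) show False by simp
  qed
  have only: "z (K, s', i') = 0" if "z \<in> Y" "z (K, s, i) \<noteq> 0" "s \<in> Pos" "s' \<in> Pos" "s' \<noteq> s" for z s s' i i'
    using Y_separated[OF that(1,2), of s' i'] that(3-5) by (force simp: Pos_def)
  have open_star: "open {z. star n v (sc s z)}" for v s
  proof -
    have c: "continuous_on UNIV (\<lambda>z. sc s z i)" for i
      unfolding sc_def by (intro continuous_intros)
    have "open {z. \<forall>i\<in>{..<n}. \<bar>sc s z i - real (v i)\<bar> < 1}"
      by (intro open_Collect_finite_ball open_Collect_less continuous_intros c) auto
    moreover have "open {z. \<forall>i\<in>{..<n}. \<forall>j\<in>{..<n}. (sc s z i - real (v i)) - (sc s z j - real (v j)) < 1}"
      by (intro open_Collect_finite_ball open_Collect_less continuous_intros c) auto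
    ultimately show ?thesis unfolding star_def by (auto intro!: open_Collect_conj simp: Ball_def)
  qed
  have "finite \<V>" using \<open>finite Idx\<close> finP by (simp add: \<V>_def)
  moreover have "\<forall>A\<in>\<V>. openin (top_of_set Y) A"
  proof
    fix A assume "A \<in> \<V>"
    have "open {z. \<forall>s\<in>Pos. star n org (sc s z)}"
      by (intro open_Collect_finite_ball finP open_star)
    then have "openin (top_of_set Y) (Y \<inter> {z. \<forall>s\<in>Pos. star n org (sc s z)})" by blast
    moreover have "openin (top_of_set Y) (Y \<inter> {z. star n v (sc s z)})" for v s
      using open_star by blast
    ultimately show "openin (top_of_set Y) A"
      using \<open>A \<in> \<V>\<close> by (auto simp: \<V>_def V0_def V_def Collect_conj_eq)
  qed
  moreover have "\<Union>\<V> = topspace (top_of_set Y)"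
  proof
    show "\<Union>\<V> \<subseteq> topspace (top_of_set Y)" by (auto simp: \<V>_def V0_def V_def)
    show "topspace (top_of_set Y) \<subseteq> \<Union>\<V>"
    proof
      fix z assume "z \<in> topspace (top_of_set Y)"
      then have z: "z \<in> Y" by simp
      obtain s where s: "s \<in> Pos" "\<And>s' i. s' \<in> Pos \<Longrightarrow> s' \<noteq> s \<Longrightarrow> z (K, s', i) = 0"
        using unique_start[OF z, of K] by (auto simp: Pos_def)
      define v where "v = (\<lambda>i\<in>{..<n}. nat \<lfloor>sc s z i\<rfloor>)"
      have sc0: "0 \<le> sc s z i" for i using Y_nonneg[OF z] by (simp add: sc_def)
      have st: "star n v (sc s z)" unfolding v_def using sc0 by (intro star_floor) auto
      have "sc s z i \<le> real N" for i
        using Y_le_1[OF z, of K s i] mult_left_mono[of "z (K, s, i)" 1 "real N"] by (simp add: sc_def)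
      then have "nat \<lfloor>sc s z i\<rfloor> \<le> N" for i
        by (metis floor_mono floor_of_nat nat_int nat_mono)
      then have "v \<in> Idx" by (auto simp: v_def Idx_def)
      show "z \<in> \<Union>\<V>"
      proof (cases "v = org")
        case True
        have "star n org (sc s' z)" if "s' \<in> Pos" for s'
        proof (cases "s' = s")
          case False
          then have "sc s' z i = 0" for i using s(2) that by (simp add: sc_def)
          then show ?thesis using star0[OF z] by simp
        qed (use st True in simp)
        then have "z \<in> V0" using z by (simp add: V0_def)
        then show ?thesis by (simp add: \<V>_def)
      next
        case False
        then have "V (s, v) \<in> \<V>" using \<open>v \<in> Idx\<close> s(1) by (auto simp: \<V>_def)
        moreover have "z \<in> V (s, v)" using z st by (simp add: V_def)
        ultimately show ?thesis by blast
      qed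
    qed
  qed
  moreover have "\<forall>A\<in>\<V>. \<exists>U\<in>\<U>. A \<subseteq> U"
  proof
    fix A assume A: "A \<in> \<V>"
    show "\<exists>U\<in>\<U>. A \<subseteq> U"
    proof (cases "A = {}")
      case True
      then show ?thesis using \<open>\<U> \<noteq> {}\<close> by blast
    next
      case False
      then obtain z where z: "z \<in> A" by blast
      have AY: "A \<subseteq> Y" using A by (auto simp: \<V>_def V0_def V_def)
      have "dist z w < e" if w: "w \<in> A" for w
      proof -
        have zw: "z \<in> Y" "w \<in> Y" using z w AY by auto
        have close: "\<bar>z (K, s, i) - w (K, s, i)\<bar> \<le> e / 3"
          if "\<bar>sc s z i - real c\<bar> < 1" "\<bar>sc s w i - real c\<bar> < 1" for s i c
        proof -
          have "real N * \<bar>z (K, s, i) - w (K, s, i)\<bar> = \<bar>sc s z i - sc s w i\<bar>"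
            by (simp add: sc_def abs_mult flip: right_diff_distrib)
          also have "\<dots> \<le> 2" using that by linarith
          finally have "\<bar>z (K, s, i) - w (K, s, i)\<bar> \<le> 2 / real N" using N(1) by (simp add: field_simps)
          with N(2) show ?thesis by linarith
        qed
        have "\<bar>z (K, s, i) - w (K, s, i)\<bar> \<le> e / 3" if s: "s \<in> Pos" and i: "i < n" for s i
        proof (cases "A = V0")
          case True
          then have "star n org (sc s z)" "star n org (sc s w)" using z w s by (auto simp: V0_def)
          then show ?thesis using i by (intro close[of s i "org i"]) (auto simp: star_def)
        next
          case False
          with A obtain s' v where v: "s' \<in> Pos" "v \<in> Idx" "v \<noteq> org" "A = V (s', v)" by (auto simp: \<V>_def)
          then have st: "star n v (sc s' z)" "star n v (sc s' w)" using z w by (auto simp: V_def)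
          show ?thesis
          proof (cases "s = s'")
            case True
            then show ?thesis using i st by (intro close[of s i "v i"]) (auto simp: star_def)
          next
            case False
            then have "z (K, s, i) = 0" "w (K, s, i) = 0"
              using only[OF zw(1) _ v(1) s] only[OF zw(2) _ v(1) s]
                star_nz[OF zw(1) v(2,3) st(1)] star_nz[OF zw(2) v(2,3) st(2)] by blast+
            then show ?thesis using e(1) by simp
          qed
        qed
        then have "dist z w < 3 * (e / 3)" using K zw by (auto simp: Pos_def)
        then show ?thesis by simp
      qed
      then have "A \<subseteq> ball z e \<inter> Y" using AY by auto
      with e(2) z AY show ?thesis by (meson order_trans subset_iff)
    qed
  qed
  moreover have "\<forall>z\<in>topspace (top_of_set Y). card {A \<in> \<V>. z \<in> A} \<le> n + 1"
  proof
    fix z assume "z \<in> topspace (top_of_set Y)"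
    then have z: "z \<in> Y" by simp
    obtain s where s: "s \<in> Pos" "\<And>s' i. s' \<in> Pos \<Longrightarrow> s' \<noteq> s \<Longrightarrow> z (K, s', i) = 0"
      using unique_start[OF z, of K] by (auto simp: Pos_def)
    define J where "J = {v \<in> Idx. star n v (sc s z)}"
    have "finite J" using \<open>finite Idx\<close> by (simp add: J_def)
    \<comment> \<open>All members through \<open>z\<close> come from its one position
      \<open>s\<close>, which reduces the count to stars in a single cube.\<close>
    have "{A \<in> \<V>. z \<in> A} \<subseteq> (\<lambda>v. if v = org then V0 else V (s, v)) ` J"
    proof
      fix A assume A: "A \<in> {A \<in> \<V>. z \<in> A}"
      show "A \<in> (\<lambda>v. if v = org then V0 else V (s, v)) ` J"
      proof (cases "A = V0")
        case True
        then have "org \<in> J" using A s(1) oI by (simp add: J_def V0_def)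
        with True show ?thesis by (intro image_eqI[of _ _ org]) auto
      next
        case False
        with A obtain s' v where v: "s' \<in> Pos" "v \<in> Idx" "v \<noteq> org" "A = V (s', v)" by (auto simp: \<V>_def)
        then have st: "star n v (sc s' z)" using A by (auto simp: V_def)
        then have "s' = s" using star_nz[OF z v(2,3)] s(2) v(1) by blast
        then show ?thesis using v st by (intro image_eqI[of _ _ v]) (auto simp: J_def)
      qed
    qed
    then have "card {A \<in> \<V>. z \<in> A} \<le> card J"
      using \<open>finite J\<close> surj_card_le by blast
    also have "\<dots> \<le> n + 1" unfolding J_def by (rule card_star_le[OF ext])
    finally show "card {A \<in> \<V>. z \<in> A} \<le> n + 1" .
  qed
  ultimately show "\<exists>\<V>. finite \<V> \<and> (\<forall>V\<in>\<V>. openin (top_of_set Y) V) \<and> \<Union>\<V> = topspace (top_of_set Y) \<and>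
      (\<forall>V\<in>\<V>. \<exists>U\<in>\<U>. V \<subseteq> U) \<and> (\<forall>x\<in>topspace (top_of_set Y). card {V \<in> \<V>. x \<in> V} \<le> n + 1)"
    by (intro exI[of _ \<V>] conjI)
qed

subsection \<open>The dimension is at least \<open>n\<close>\<close>

text \<open>Sperner's lemma for the cube: color a grid point by the first coordinate \<open>c\<close> for which the
  chosen member of the cover touches the face where coordinate \<open>c\<close> is \<open>1\<close>.\<close>

lemma not_covering_dim_le_Y:
  assumes "n \<ge> 1"
  shows "\<not> covering_dim_le (top_of_set Y) (n - 1)"
proof
  assume dim: "covering_dim_le (top_of_set Y) (n - 1)"
  \<comment> \<open>For each coordinate a member of this cover avoids one of the two opposite faces:
    the face at \<open>1\<close> for \<open>i \<in> I\<close>, the face at \<open>0\<close>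
    otherwise. Every refinement inherits this.\<close>
  define U where "U I = {z \<in> Y. (\<forall>i\<in>I. z (0, 0, i) < 1) \<and> (\<forall>i\<in>{..<n} - I. 0 < z (0, 0, i))}" for I
  have openU: "openin (top_of_set Y) (U I)" if "I \<subseteq> {..<n}" for I
  proof -
    have "finite I" using that finite_subset by blast
    then have "open {z :: config. (\<forall>i\<in>I. z (0, 0, i) < 1) \<and> (\<forall>i\<in>{..<n} - I. 0 < z (0, 0, i))}"
      by (intro open_Collect_conj open_Collect_finite_ball open_Collect_less continuous_intros) auto
    moreover have "U I = Y \<inter> {z. (\<forall>i\<in>I. z (0, 0, i) < 1) \<and> (\<forall>i\<in>{..<n} - I. 0 < z (0, 0, i))}"
      by (auto simp: U_def)
    ultimately show ?thesis by (simp add: openin_open_Int)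
  qed
  have "\<Union>(U ` Pow {..<n}) = Y"
  proof
    show "Y \<subseteq> \<Union>(U ` Pow {..<n})"
    proof
      fix z assume "z \<in> Y"
      then have "z \<in> U {i. i < n \<and> z (0, 0, i) < 1}" by (auto simp: U_def)
      then show "z \<in> \<Union>(U ` Pow {..<n})" by (rule UN_I[rotated]) auto
    qed
    have "U I \<subseteq> Y" for I by (simp add: U_def)
    then show "\<Union>(U ` Pow {..<n}) \<subseteq> Y" by (intro UN_least)
  qed
  then have "finite (U ` Pow {..<n}) \<and> (\<forall>B\<in>U ` Pow {..<n}. openin (top_of_set Y) B) \<and>
      \<Union>(U ` Pow {..<n}) = topspace (top_of_set Y)"
    using openU by simp
  from dim[unfolded covering_dim_le_def, THEN spec, THEN mp, OF this]
  obtain \<V> where \<V>': "finite \<V>" "\<forall>A\<in>\<V>. openin (top_of_set Y) A" "\<Union>\<V> = topspace (top_of_set Y)"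
    "\<forall>A\<in>\<V>. \<exists>B\<in>U ` Pow {..<n}. A \<subseteq> B" "\<forall>x\<in>topspace (top_of_set Y). card {A \<in> \<V>. x \<in> A} \<le> (n - 1) + 1"
    by (elim exE conjE)
  then have \<V>: "finite \<V>" "\<And>A. A \<in> \<V> \<Longrightarrow> openin (top_of_set Y) A" "\<Union>\<V> = Y"
    "\<And>A. A \<in> \<V> \<Longrightarrow> \<exists>B\<in>U ` Pow {..<n}. A \<subseteq> B" "\<And>x. x \<in> Y \<Longrightarrow> card {A \<in> \<V>. x \<in> A} \<le> (n - 1) + 1"
    by simp_all
  obtain e where e: "e > 0" "\<And>x. x \<in> Y \<Longrightarrow> \<exists>A\<in>\<V>. ball x e \<inter> Y \<subseteq> A"
    using lebesgue_number_openin[OF compact_Y \<V>(2,3)] by auto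
  have "e / 3 > 0" using e(1) by simp
  from dist_config_bound[OF this] obtain J :: "(nat \<times> int \<times> nat) set"
    where "\<forall>z w. (\<forall>x\<in>J. \<bar>z x - w x\<bar> \<le> e / 3) \<longrightarrow> dist z w < 3 * (e / 3)" by blast
  then have close: "dist z w < e" if "\<And>x. \<bar>z x - w x\<bar> \<le> e / 3" for z w :: config
    using that by simp
  obtain p0 :: nat where "1 / (e / 3) < real p0" using reals_Archimedean2 by blast
  then obtain p :: nat where p: "p > 0" "1 / real p \<le> e / 3"
    using e(1) by (intro that[of "Suc p0"]) (auto simp: field_simps)
  \<comment> \<open>The \<open>min\<close> keeps the point in the cube for all \<open>x\<close>, as
    labels must be defined beyond the grid too.\<close>
  define pt where "pt x = (\<lambda>i. if i < n then min 1 (real (x i) / real p) else 0)" for x :: "nat \<Rightarrow> nat"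
  have pt: "pt x \<in> unit_cube" for x using p by (auto simp: pt_def unit_cube_def)
  define \<psi> where "\<psi> x = anchored_point (pt x)" for x
  have \<psi>: "\<psi> x \<in> Y" "\<psi> x (0, 0, i) = pt x i" for x i
    using anchored_point(1)[OF pt] anchored_point(2)[OF pt, of x 0 i] by (simp_all add: \<psi>_def)
  define A where "A x = (SOME B. B \<in> \<V> \<and> ball (\<psi> x) e \<inter> Y \<subseteq> B)" for x
  have A: "A x \<in> \<V>" "ball (\<psi> x) e \<inter> Y \<subseteq> A x" for x
  proof -
    have "\<exists>B. B \<in> \<V> \<and> ball (\<psi> x) e \<inter> Y \<subseteq> B" using e(2)[OF \<psi>(1)] by blast
    from someI_ex[OF this] show "A x \<in> \<V>" "ball (\<psi> x) e \<inter> Y \<subseteq> A x" unfolding A_def by auto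
  qed
  have \<psi>A: "\<psi> x \<in> A x" for x using A(2)[of x] e(1) \<psi>(1)[of x] by (meson IntI centre_in_ball subsetD)
  define touch where "touch B c \<longleftrightarrow> (\<exists>z\<in>B. z (0, 0, c) = 1)" for B :: "config set" and c :: nat
  define col where "col B = (LEAST c. c = n \<or> touch B c)" for B
  have col_le: "col B \<le> n" for B unfolding col_def by (rule Least_le) simp
  have col_touch: "touch B (col B)" if "col B \<noteq> n" for B
    using LeastI[of "\<lambda>c. c = n \<or> touch B c" n] that by (auto simp: col_def)
  have col_least: "col B \<le> c" if "touch B c" for B c
    unfolding col_def using that by (intro Least_le) simp
  \<comment> \<open>\<open>reduced\<close> finds the first nonzero label, so it returns
    \<open>col (A x)\<close>. Labels after that index are free and are chosen to meet the boundary
    conditions of \<open>kuhn_combinatorial\<close>.\<close>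
  define lab where "lab x i = (if i < col (A x) then 0 else if i = col (A x) then 1
      else if x i = 0 then 0 else 1 :: nat)" for x :: "nat \<Rightarrow> nat" and i
  have red: "reduced n (lab x) = col (A x)" for x
    using col_le by (intro reduced_labelling_unique) (auto simp: lab_def)
  have no_opposite: "0 < z (0, 0, c)" if B: "B \<in> \<V>" and t: "touch B c" and z: "z \<in> B" and c: "c < n" for B c z
  proof -
    obtain I where I: "B \<subseteq> U I" using \<V>(4)[OF B] by blast
    obtain z' where "z' \<in> B" "z' (0, 0, c) = 1" using t by (auto simp: touch_def)
    then have "c \<notin> I" using I by (force simp: U_def)
    then show ?thesis using I z c by (auto simp: U_def)
  qed
  have "odd (card {s. ksimplex p n s \<and> (reduced n \<circ> lab) ` s = {..n}})"
  proof (rule kuhn_combinatorial[OF p(1)])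
    show "\<forall>x j. (\<forall>j. x j \<le> p) \<and> j < n \<and> x j = 0 \<longrightarrow> lab x j = 0"
    proof (intro allI impI, elim conjE)
      fix x :: "nat \<Rightarrow> nat" and j assume j: "j < n" "x j = 0"
      \<comment> \<open>Otherwise \<open>A x\<close> would touch the face at \<open>1\<close> in
        direction \<open>j\<close> and also contain \<open>\<psi> x\<close>, which lies on the face
        at \<open>0\<close>.\<close>
      have "j \<noteq> col (A x)"
      proof
        assume c: "j = col (A x)"
        then have "0 < \<psi> x (0, 0, j)"
          using col_touch[of "A x"] j by (intro no_opposite[OF A(1) _ \<psi>A]) auto
        then show False using j p by (simp add: \<psi>(2) pt_def)
      qed
      with j show "lab x j = 0" by (simp add: lab_def)
    qed
    show "\<forall>x j. (\<forall>j. x j \<le> p) \<and> j < n \<and> x j = p \<longrightarrow> lab x j = 1"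
    proof (intro allI impI, elim conjE)
      fix x :: "nat \<Rightarrow> nat" and j assume j: "j < n" "x j = p"
      then have "\<psi> x (0, 0, j) = 1" using p by (simp add: \<psi>(2) pt_def)
      then have "touch (A x) j" using \<psi>A by (auto simp: touch_def)
      then have "col (A x) \<le> j" by (rule col_least)
      with j p show "lab x j = 1" by (simp add: lab_def)
    qed
  qed
  then have "{s. ksimplex p n s \<and> (reduced n \<circ> lab) ` s = {..n}} \<noteq> {}"
    by (rule odd_card_imp_not_empty)
  then obtain s b u where ks: "kuhn_simplex p n b u s" and s: "(reduced n \<circ> lab) ` s = {..n}"
    by (auto elim: ksimplex.cases)
  interpret ks: kuhn_simplex p n b u s by fact
  have "s \<noteq> {}" using s by auto
  then obtain x0 where x0: "x0 \<in> s" by blast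
  have "\<psi> x0 \<in> A x" if "x \<in> s" for x
  proof -
    have "\<bar>pt x i - pt x0 i\<bar> \<le> e / 3" for i
    proof (cases "i < n")
      case True
      have "\<bar>real (x i) - real (x0 i)\<bar> \<le> 1"
        using ks.base_le[OF that, of i] ks.le_Suc_base[OF that, of i] ks.base_le[OF x0, of i] ks.le_Suc_base[OF x0, of i]
        by linarith
      then have "\<bar>real (x i) / real p - real (x0 i) / real p\<bar> \<le> 1 / real p"
        using p(1) by (simp add: divide_right_mono flip: diff_divide_distrib)
      moreover have "\<bar>min 1 a - min 1 b\<bar> \<le> \<bar>a - b\<bar>" for a b :: real
        by (auto simp: min_def abs_if)
      ultimately have "\<bar>pt x i - pt x0 i\<bar> \<le> 1 / real p"
        unfolding pt_def using True by (auto intro: order_trans)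
      with p(2) show ?thesis by linarith
    qed (use e(1) in \<open>simp add: pt_def\<close>)
    then have "\<bar>\<psi> x y - \<psi> x0 y\<bar> \<le> e / 3" for y
      unfolding \<psi>_def using e(1) anchored_point_lipschitz[OF pt pt, of "e / 3"]
      by (cases y) simp
    then have "\<psi> x0 \<in> ball (\<psi> x) e \<inter> Y" using close \<psi>(1) by simp
    then show ?thesis using A(2) by blast
  qed
  then have sub: "A ` s \<subseteq> {B \<in> \<V>. \<psi> x0 \<in> B}" using A(1) by auto
  \<comment> \<open>The color is a function of the member, so \<open>n + 1\<close> colors on one
    simplex give \<open>n + 1\<close> distinct members, all containing
    \<open>\<psi> x0\<close>.\<close>
  have "(\<lambda>x. col (A x)) ` s = {..n}" using s by (simp add: red o_def)
  then have "col ` (A ` s) = {..n}" by (simp add: image_image)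
  then have "n + 1 \<le> card (A ` s)"
    using card_image_le[of "A ` s" col] finite_subset[OF sub] \<V>(1) by simp
  also have "\<dots> \<le> card {B \<in> \<V>. \<psi> x0 \<in> B}" using sub \<V>(1) by (intro card_mono) auto
  also have "\<dots> \<le> (n - 1) + 1" by (rule \<V>(5)[OF \<psi>(1)])
  finally show False using assms by simp
qed

end

section \<open>Transfer to the reals\<close>

lemma covering_dim_le_homeomorphic:
  assumes "X homeomorphic_space X'" "covering_dim_le X n"
  shows "covering_dim_le X' n"
  unfolding covering_dim_le_def
proof (intro allI impI)
  fix \<U> assume \<U>: "finite \<U> \<and> (\<forall>U\<in>\<U>. openin X' U) \<and> \<Union>\<U> = topspace X'"
  obtain f g where fg: "homeomorphic_maps X X' f g" using assms(1) by (auto simp: homeomorphic_space_def)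
  then have gf: "\<And>x. x \<in> topspace X \<Longrightarrow> g (f x) = x" "\<And>y. y \<in> topspace X' \<Longrightarrow> f (g y) = y"
    and hf: "homeomorphic_map X X' f" and hg: "homeomorphic_map X' X g"
    by (auto simp: homeomorphic_maps_map)
  have im: "f ` topspace X = topspace X'" "g ` topspace X' = topspace X"
    using hf hg by (simp_all add: homeomorphic_imp_surjective_map)
  have op: "openin X' (f ` V)" if "openin X V" for V
    using homeomorphic_imp_open_map[OF hf] that by (simp add: open_map_def)
  have og: "openin X (g ` V)" if "openin X' V" for V
    using homeomorphic_imp_open_map[OF hg] that by (simp add: open_map_def)
  have "finite ((`) g ` \<U>) \<and> (\<forall>U\<in>(`) g ` \<U>. openin X U) \<and> \<Union>((`) g ` \<U>) = topspace X"
    using \<U> og im(2) by (simp flip: image_Union)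
  from assms(2)[unfolded covering_dim_le_def, THEN spec, THEN mp, OF this]
  obtain \<V> where \<V>: "finite \<V>" "\<forall>V\<in>\<V>. openin X V" "\<Union>\<V> = topspace X"
    "\<forall>V\<in>\<V>. \<exists>U\<in>(`) g ` \<U>. V \<subseteq> U" "\<forall>x\<in>topspace X. card {V \<in> \<V>. x \<in> V} \<le> n + 1"
    by (elim exE conjE)
  have "finite ((`) f ` \<V>)" using \<V>(1) by simp
  moreover have "\<forall>V\<in>(`) f ` \<V>. openin X' V" using \<V>(2) op by simp
  moreover have "\<Union>((`) f ` \<V>) = topspace X'" using \<V>(3) im(1) by (simp flip: image_Union)
  moreover have "\<forall>V\<in>(`) f ` \<V>. \<exists>U\<in>\<U>. V \<subseteq> U"
  proof
    fix V' assume "V' \<in> (`) f ` \<V>"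
    then obtain V where V: "V \<in> \<V>" "V' = f ` V" by blast
    then obtain U where U: "U \<in> \<U>" "V \<subseteq> g ` U" using \<V>(4) by blast
    have "f (g y) = y" if "y \<in> U" for y using \<U> U(1) that gf(2) by blast
    then have "f ` g ` U = U" by force
    then have "V' \<subseteq> U" using V(2) image_mono[OF U(2), of f] by simp
    with U(1) show "\<exists>U\<in>\<U>. V' \<subseteq> U" by blast
  qed
  moreover have "\<forall>y\<in>topspace X'. card {V \<in> (`) f ` \<V>. y \<in> V} \<le> n + 1"
  proof
    fix y assume y: "y \<in> topspace X'"
    then have gy: "g y \<in> topspace X" using im(2) by blast
    have "{V \<in> (`) f ` \<V>. y \<in> V} \<subseteq> (`) f ` {V \<in> \<V>. g y \<in> V}"
    proof
      fix V' assume "V' \<in> {V \<in> (`) f ` \<V>. y \<in> V}"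
      then obtain V v where V: "V \<in> \<V>" "V' = f ` V" "v \<in> V" "y = f v" by blast
      then have "g y = v" using \<V>(3) gf(1) by blast
      with V show "V' \<in> (`) f ` {V \<in> \<V>. g y \<in> V}" by simp
    qed
    then have "card {V \<in> (`) f ` \<V>. y \<in> V} \<le> card {V \<in> \<V>. g y \<in> V}"
      using \<V>(1) by (intro surj_card_le) simp_all
    also have "\<dots> \<le> n + 1" using \<V>(5) gy by blast
    finally show "card {V \<in> (`) f ` \<V>. y \<in> V} \<le> n + 1" .
  qed
  ultimately show "\<exists>\<V>. finite \<V> \<and> (\<forall>V\<in>\<V>. openin X' V) \<and> \<Union>\<V> = topspace X' \<and>
      (\<forall>V\<in>\<V>. \<exists>U\<in>\<U>. V \<subseteq> U) \<and> (\<forall>x\<in>topspace X'. card {V \<in> \<V>. x \<in> V} \<le> n + 1)"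
    by (intro exI[of _ "(`) f ` \<V>"] conjI)
qed

text \<open>A point of a T0 space is determined by the basic open sets that contain it; with a
  countable basis this embeds the space in the sets of naturals, which are equinumerous with the
  reals.\<close>

lemma exists_inj_to_real: "\<exists>J :: 'a :: {second_countable_topology, t0_space} \<Rightarrow> real. inj J"
proof -
  obtain B :: "nat \<Rightarrow> 'a set" where B: "\<And>U x. open U \<Longrightarrow> x \<in> U \<Longrightarrow> \<exists>i. x \<in> B i \<and> B i \<subseteq> U"
  proof -
    obtain \<B> :: "'a set set" where \<B>: "countable \<B>" "topological_basis \<B>"
      using ex_countable_basis by blast
    show ?thesis
    proof (rule that[of "from_nat_into \<B>"])
      fix U :: "'a set" and x assume "open U" "x \<in> U"
      then obtain b where "b \<in> \<B>" "x \<in> b" "b \<subseteq> U" using topological_basisE[OF \<B>(2)] by metis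
      then show "\<exists>i. x \<in> from_nat_into \<B> i \<and> from_nat_into \<B> i \<subseteq> U"
        using from_nat_into_surj[OF \<B>(1)] by metis
    qed
  qed
  have "inj (\<lambda>x. {i. x \<in> B i})"
  proof (rule injI, rule ccontr)
    fix x y :: 'a assume eq: "{i. x \<in> B i} = {i. y \<in> B i}" and "x \<noteq> y"
    then obtain U where U: "open U" "x \<in> U \<longleftrightarrow> y \<notin> U" using t0_space_class.t0_space[of x y] by blast
    show False
    proof (cases "x \<in> U")
      case True
      then show False using B[OF U(1) True] eq U(2) by blast
    next
      case False
      then have "y \<in> U" using U(2) by blast
      then show False using B[OF U(1)] eq False by blast
    qed
  qed
  moreover have "(UNIV :: nat set set) \<lesssim> (UNIV :: real set)"
    by (rule eqpoll_imp_lepoll[OF nat_sets_eqpoll_reals])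
  then obtain J :: "nat set \<Rightarrow> real" where "inj J" by (auto simp: lepoll_def)
  ultimately have "inj (J \<circ> (\<lambda>x. {i. x \<in> B i}))" by (intro inj_compose)
  then show ?thesis by blast
qed

lemma funpow_prod:
  fixes f :: "'a \<Rightarrow> 'a"
  shows "((\<lambda>(x, y). (f x, f y)) ^^ m) (a, b) = ((f ^^ m) a, (f ^^ m) b)"
  by (induction m) auto

text \<open>A nonempty open set of the product contains a product of two balls, and one radius can
  serve both open sets; four centres remain.\<close>

lemma weakly_mixingI:
  assumes "\<And>u1 u2 u3 u4 e. u1 \<in> mspace m \<Longrightarrow> u2 \<in> mspace m \<Longrightarrow> u3 \<in> mspace m \<Longrightarrow> u4 \<in> mspace m \<Longrightarrow>
      0 < e \<Longrightarrow> \<exists>k>0. \<exists>x\<in>mspace m. \<exists>y\<in>mspace m. (f ^^ k) x \<in> mspace m \<and> (f ^^ k) y \<in> mspace m \<and>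
        mdist m u1 x < e \<and> mdist m u2 ((f ^^ k) x) < e \<and> mdist m u3 y < e \<and> mdist m u4 ((f ^^ k) y) < e"
  shows "weakly_mixing (mtopology_of m) f"
  unfolding weakly_mixing_def top_transitive_def
proof (intro allI impI, elim conjE)
  interpret Metric_space "mspace m" "mdist m" by simp
  fix U V
  assume U: "openin (prod_topology (mtopology_of m) (mtopology_of m)) U" "U \<noteq> {}"
    and V: "openin (prod_topology (mtopology_of m) (mtopology_of m)) V" "V \<noteq> {}"
  have box: "\<exists>u w e. u \<in> mspace m \<and> w \<in> mspace m \<and> 0 < e \<and>
      (\<forall>x\<in>mspace m. \<forall>y\<in>mspace m. mdist m u x < e \<and> mdist m w y < e \<longrightarrow> (x, y) \<in> A)"
    if A: "openin (prod_topology (mtopology_of m) (mtopology_of m)) A" "A \<noteq> {}" for A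
  proof -
    obtain u w where uw: "(u, w) \<in> A" using A(2) by auto
    obtain P Q where PQ: "openin (mtopology_of m) P" "openin (mtopology_of m) Q" "u \<in> P" "w \<in> Q" "P \<times> Q \<subseteq> A"
      using A(1)[unfolded openin_prod_topology_alt] uw by meson
    obtain r where r: "r > 0" "mball u r \<subseteq> P" using PQ(1,3) by (auto simp: mtopology_of_def openin_mtopology)
    obtain r' where r': "r' > 0" "mball w r' \<subseteq> Q" using PQ(2,4) by (auto simp: mtopology_of_def openin_mtopology)
    have uw': "u \<in> mspace m" "w \<in> mspace m"
      using PQ openin_subset by fastforce+
    have "(x, y) \<in> A" if "x \<in> mspace m" "y \<in> mspace m" "mdist m u x < min r r'" "mdist m w y < min r r'" for x y
    proof -
      have "x \<in> mball u r" "y \<in> mball w r'" using that uw' by auto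
      with r r' PQ(5) show ?thesis by blast
    qed
    then show ?thesis using r(1) r'(1) uw' by (intro exI[of _ u] exI[of _ w] exI[of _ "min r r'"]) auto
  qed
  obtain u1 u3 e1 where 1: "u1 \<in> mspace m" "u3 \<in> mspace m" "0 < e1"
    "\<And>x y. x \<in> mspace m \<Longrightarrow> y \<in> mspace m \<Longrightarrow> mdist m u1 x < e1 \<Longrightarrow> mdist m u3 y < e1 \<Longrightarrow> (x, y) \<in> U"
    using box[OF U] by metis
  obtain u2 u4 e2 where 2: "u2 \<in> mspace m" "u4 \<in> mspace m" "0 < e2"
    "\<And>x y. x \<in> mspace m \<Longrightarrow> y \<in> mspace m \<Longrightarrow> mdist m u2 x < e2 \<Longrightarrow> mdist m u4 y < e2 \<Longrightarrow> (x, y) \<in> V"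
    using box[OF V] by metis
  have "0 < min e1 e2" using 1(3) 2(3) by simp
  from assms[OF 1(1) 2(1) 1(2) 2(2) this] obtain k x y where k: "k > 0" "x \<in> mspace m" "y \<in> mspace m"
    "(f ^^ k) x \<in> mspace m" "(f ^^ k) y \<in> mspace m"
    "mdist m u1 x < min e1 e2" "mdist m u2 ((f ^^ k) x) < min e1 e2"
    "mdist m u3 y < min e1 e2" "mdist m u4 ((f ^^ k) y) < min e1 e2" by blast
  have "(x, y) \<in> U" using k by (intro 1(4)) auto
  moreover have "((f ^^ k) x, (f ^^ k) y) \<in> V" using k by (intro 2(4)) auto
  ultimately have "((\<lambda>(x, y). (f x, f y)) ^^ k) (x, y) \<in> ((\<lambda>(x, y). (f x, f y)) ^^ k) ` U \<inter> V"
    by (auto simp: funpow_prod intro: image_eqI[where x = "(x, y)"])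
  with k(1) show "\<exists>k>0. ((\<lambda>(x, y). (f x, f y)) ^^ k) ` U \<inter> V \<noteq> {}" by blast
qed

text \<open>The block of level \<open>k\<close> depends on \<open>h k\<close>, which comes from the
  block below. Blocks are therefore chosen for all lengths and levels at once, and the recursion for
  \<open>h\<close> runs afterwards.\<close>

lemma exists_tower: "\<exists>h W g. tower n h W g"
proof -
  have "\<exists>W g. 1 \<le> h \<longrightarrow> slow_block n h ((1/2) ^ k) W g \<and> mixing_block n h ((1/2) ^ k) W g" for h k
    using exists_block[of h "(1/2) ^ k" n] by auto
  then obtain W g where Wg: "\<And>h k. 1 \<le> h \<Longrightarrow>
     slow_block n h ((1/2) ^ k) (W h k) (g h k) \<and> mixing_block n h ((1/2) ^ k) (W h k) (g h k)"
    by metis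
  define h where "h = rec_nat (1 :: int) (\<lambda>k h. 8 * W h k)"
  have h: "h 0 = 1" "h (Suc k) = 8 * W (h k) k" for k by (simp_all add: h_def)
  have h1: "1 \<le> h k" for k
  proof (induction k)
    case (Suc k)
    have "slow_block n (h k) ((1/2) ^ k) (W (h k) k) (g (h k) k)" using Wg[OF Suc] by blast
    then have "4 * h k \<le> W (h k) k" unfolding slow_block_def by (rule conjunct1)
    with Suc show ?case by (simp add: h)
  qed (simp add: h)
  have "tower n h (\<lambda>k. W (h k) k) (\<lambda>k. g (h k) k)"
    using h Wg[OF h1] by unfold_locales simp_all
  then show ?thesis by blast
qed

section \<open>Realisation of the system on a set of reals\<close>

context tower
begin

lemma homeomorphic_map_shift: "homeomorphic_map (top_of_set Y) (top_of_set Y) shift"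
proof (rule continuous_imp_homeomorphic_map)
  show "continuous_map (top_of_set Y) (top_of_set Y) shift"
    using continuous_on_subset[OF continuous_shift, of Y] shift_image_Y by auto
  show "compact_space (top_of_set Y)" using compact_Y by (simp add: compact_space_subtopology)
  show "Hausdorff_space (top_of_set Y)" by (simp add: Hausdorff_space_subtopology)
  show "shift ` topspace (top_of_set Y) = topspace (top_of_set Y)" using shift_image_Y by simp
  show "inj_on shift (topspace (top_of_set Y))" using inj_on_subset[OF inj_shift] by simp
qed

text \<open>The space \<open>Y\<close> has the cardinality of the continuum at most, so its metric can be carried
  over to a set of reals.\<close>

lemma exists_real_model:
  assumes dim: "covering_dim_eq (top_of_set Y) n"
  shows "\<exists>(m :: real metric) S.
           compact_space (mtopology_of m) \<and>
           covering_dim_eq (mtopology_of m) n \<and>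
           homeomorphic_map (mtopology_of m) (mtopology_of m) S \<and>
           weakly_mixing (mtopology_of m) S \<and>
           completely_scrambled m S"
proof -
  obtain J :: "config \<Rightarrow> real" where J: "inj J" using exists_inj_to_real by blast
  define I where "I = inv J"
  have IJ [simp]: "I (J z) = z" for z using J by (simp add: I_def)
  define d where "d a b = dist (I a) (I b)" for a b
  have "Metric_space (J ` Y) d"
    by unfold_locales (auto simp: d_def dist_commute dist_triangle)
  then interpret M: Metric_space "J ` Y" d .
  interpret Sub: Submetric UNIV "dist :: config \<Rightarrow> config \<Rightarrow> real" Y by unfold_locales simp
  have "Metric_space12 Y dist (J ` Y) d" by unfold_locales
  then interpret M12: Metric_space12 Y dist "J ` Y" d .
  define m where "m = metric (J ` Y, d)"
  have m: "mspace m = J ` Y" "mdist m = d" "mtopology_of m = M.mtopology"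
    by (simp_all add: m_def)
  have topY: "Sub.sub.mtopology = top_of_set Y" using Sub.mtopology_submetric by simp
  have dJ: "d (J z) (J w) = dist z w" for z w by (simp add: d_def)
  have homJ: "homeomorphic_map (top_of_set Y) (mtopology_of m) J"
    unfolding m(3) topY[symmetric] by (rule M12.isometry_imp_homeomorphic_map) (auto simp: dJ)
  have homI: "homeomorphic_map (mtopology_of m) (top_of_set Y) I"
  proof -
    interpret M21: Metric_space12 "J ` Y" d Y dist by unfold_locales
    have "I ` J ` Y = Y" by (simp add: image_image)
    then show ?thesis
      unfolding m(3) topY[symmetric] by (rule M21.isometry_imp_homeomorphic_map) (simp add: d_def)
  qed
  have hs: "top_of_set Y homeomorphic_space mtopology_of m"
    using homJ homeomorphic_map_imp_homeomorphic_space by blast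
  define S where "S = J \<circ> shift \<circ> I"
  have Spow: "(S ^^ k) (J z) = J ((shift ^^ k) z)" for k z
    by (induction k) (simp_all add: S_def)
  have "compact_space (mtopology_of m)"
    using homeomorphic_compact_space[OF hs] compact_Y by (simp add: compact_space_subtopology)
  moreover have "covering_dim_eq (mtopology_of m) n"
    using dim covering_dim_le_homeomorphic[OF hs, of n]
      covering_dim_le_homeomorphic[OF hs[THEN homeomorphic_space_sym[THEN iffD1]], of "n - 1"]
    unfolding covering_dim_eq_def by blast
  moreover have "homeomorphic_map (mtopology_of m) (mtopology_of m) S"
    unfolding S_def by (intro homeomorphic_map_compose[OF homI] homeomorphic_map_compose[OF _ homJ] homeomorphic_map_shift)
  moreover have "weakly_mixing (mtopology_of m) S"
  proof (rule weakly_mixingI)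
    fix u1 u2 u3 u4 and e :: real
    assume "u1 \<in> mspace m" "u2 \<in> mspace m" "u3 \<in> mspace m" "u4 \<in> mspace m" "0 < e"
    then obtain v1 v2 v3 v4 where v: "u1 = J v1" "u2 = J v2" "u3 = J v3" "u4 = J v4"
      "v1 \<in> Y" "v2 \<in> Y" "v3 \<in> Y" "v4 \<in> Y" by (auto simp: m)
    obtain k x y where k: "k > 0" "x \<in> Y" "y \<in> Y" "dist x v1 < e" "dist ((shift ^^ k) x) v2 < e"
      "dist y v3 < e" "dist ((shift ^^ k) y) v4 < e"
      using weak_mixing_points[OF v(5-8) \<open>0 < e\<close>] by blast
    show "\<exists>k>0. \<exists>x\<in>mspace m. \<exists>y\<in>mspace m. (S ^^ k) x \<in> mspace m \<and> (S ^^ k) y \<in> mspace m \<and>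
        mdist m u1 x < e \<and> mdist m u2 ((S ^^ k) x) < e \<and> mdist m u3 y < e \<and> mdist m u4 ((S ^^ k) y) < e"
      using k shift_funpow_Y
      by (intro exI[of _ k] conjI bexI[of _ "J x"] bexI[of _ "J y"]) (simp_all add: v m Spow dJ dist_commute)
  qed
  moreover have "completely_scrambled m S"
    unfolding completely_scrambled_def
  proof (intro ballI impI)
    fix a b assume "a \<in> mspace m" "b \<in> mspace m" "a \<noteq> b"
    then obtain z w where zw: "a = J z" "b = J w" "z \<in> Y" "w \<in> Y" "z \<noteq> w" by (auto simp: m)
    have "proximal_pair m S a b"
      unfolding proximal_pair_def using proximal[OF zw(3,4)] by (simp add: zw m Spow dJ)
    moreover have "\<not> asymptotic_pair m S a b"
      unfolding asymptotic_pair_def using not_asymptotic[OF zw(3-5)]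
      by (auto simp: zw m Spow dJ not_less)
    ultimately show "li_yorke_pair m S a b" by (simp add: li_yorke_pair_def)
  qed
  ultimately show ?thesis by blast
qed

end

theorem theorem1p3:
  fixes n :: nat
  assumes "n \<ge> 1"
  shows "\<exists>(m :: real metric) S.
           compact_space (mtopology_of m) \<and>
           covering_dim_eq (mtopology_of m) n \<and>
           homeomorphic_map (mtopology_of m) (mtopology_of m) S \<and>
           weakly_mixing (mtopology_of m) S \<and>
           completely_scrambled m S"
proof -
  obtain h W g where "tower n h W g" using exists_tower by blast
  then interpret tower n h W g .
  have "covering_dim_eq (top_of_set Y) n"
    using covering_dim_le_Y not_covering_dim_le_Y[OF assms] by (simp add: covering_dim_eq_def)
  then show ?thesis by (rule exists_real_model)
qed

end
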